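(* Let $(\xi_m)_{m\ge1}$ be the random process of matchings generated by the dynamic pairing scheme described in the context, where $\xi_m$ is a uniform random perfect matching of $\{1,\dots,2m\}$ for each $m$. For $t\in\mathbb{N}$ let $\mathscr{F}_t^+=\sigma(\xi_{t+1},\xi_{t+2},\dots)$. Then the tail $\sigma$-algebra $$\mathscr{T}=\bigcap_{t\in\mathbb{N}}\mathscr{F}_t^+$$ is trivial: $\mathbb{P}[A]\in\{0,1\}$ for every $A\in\mathscr{T}$.
   Context: The dynamic pairing scheme: $\xi_1=\{(1,2)\}$, and given $\xi_m$ (a perfect matching of $\{1,\dots,2m\}$), draw $u_1$ uniform on $\{1,\dots,2m\}$ and $u_2$ uniform on $\{1,\dots,2m,2m+1\}$, independently of each other and of the past. - If $u_2=2m+1$, set $\xi_{m+1}=\xi_m\cup\{(2m+1,2m+2)\}$. - If $u_2\ne2m+1$ and $u_1\ne u_2$, remove from $\xi_m$ the pairs containing $u_1$ or $u_2$ and add the pairs $(2m+1,u_1)$ and $(2m+2,u_2)$. - If $u_2\neq 2m+1$ and $u_1=u_2$, remove from $\xi_m$ the pair containing $u_2$ and add the pair $(2m+2,u_2)$. In the last two cases, if two points of $\{1,\dots,2m+2\}$ remain unpaired, pair them with each other and add this pair. The result is $\xi_{m+1}$, a perfect matching of $\{1,\dots,2m+2\}$. (Given a degree sequence $(d_i)$, assigning consecutive blocks of $d_1,d_2,\dots$ integers as half-edges of vertices $v_1,v_2,\dots$ turns these matchings into a process of Configuration Model multigraphs.) *)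

theory Defs
  imports "HOL-Probability.Probability"
begin

text \<open>A matching is a set of unordered pairs, i.e. a set of two-element sets. The step from a
  matching of \<open>{1..2 * m}\<close> to one of \<open>{1..2 * m + 2}\<close> is deterministic given the draws \<open>u1\<close>, \<open>u2\<close>.\<close>

definition pair_remaining :: "nat set \<Rightarrow> nat set set \<Rightarrow> nat set set" where
  "pair_remaining S X = (if card (S - \<Union> X) = 2 then insert (S - \<Union> X) X else X)"

definition pairing_step :: "nat \<Rightarrow> nat set set \<Rightarrow> nat \<Rightarrow> nat \<Rightarrow> nat set set" where
  "pairing_step m X u1 u2 =
    (if u2 = 2 * m + 1 then X \<union> {{2 * m + 1, 2 * m + 2}}
     else if u1 \<noteq> u2 then
       pair_remaining {1..2 * m + 2}
         ({p \<in> X. u1 \<notin> p \<and> u2 \<notin> p} \<union> {{2 * m + 1, u1}, {2 * m + 2, u2}})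
     else
       pair_remaining {1..2 * m + 2} ({p \<in> X. u2 \<notin> p} \<union> {{2 * m + 2, u2}}))"

text \<open>All processes are indexed by \<open>m \<ge> 1\<close>; their values at index \<open>0\<close> are irrelevant. The draws
  \<open>U1 m\<close>, \<open>U2 m\<close> (\<open>m \<ge> 1\<close>) form one mutually independent family, indexed by a disjoint sum.\<close>

locale dynamic_pairing = prob_space M for M :: "'a measure" +
  fixes U1 U2 :: "nat \<Rightarrow> 'a \<Rightarrow> nat"
    and \<xi> :: "nat \<Rightarrow> 'a \<Rightarrow> nat set set"
  assumes indep_draws:
      "indep_vars (\<lambda>_. count_space UNIV) (case_sum U1 U2) ({1..} <+> {1..})"
    and uniform_U1: "\<And>m. m \<ge> 1 \<Longrightarrow>
      distr M (count_space UNIV) (U1 m) = measure_pmf (pmf_of_set {1..2 * m})"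
    and uniform_U2: "\<And>m. m \<ge> 1 \<Longrightarrow>
      distr M (count_space UNIV) (U2 m) = measure_pmf (pmf_of_set {1..2 * m + 1})"
    and initial: "\<And>\<omega>. \<omega> \<in> space M \<Longrightarrow> \<xi> 1 \<omega> = {{1, 2}}"
    and step: "\<And>m \<omega>. m \<ge> 1 \<Longrightarrow> \<omega> \<in> space M \<Longrightarrow>
      \<xi> (m + 1) \<omega> = pairing_step m (\<xi> m \<omega>) (U1 m \<omega>) (U2 m \<omega>)"

text \<open>The sigma-algebra generated by the values of a process of discrete random variables at the
  times \<open>t + 1, t + 2, \<dots>\<close>.\<close>

definition future_sigma :: "'a measure \<Rightarrow> (nat \<Rightarrow> 'a \<Rightarrow> 'b) \<Rightarrow> nat \<Rightarrow> 'a set set" where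
  "future_sigma M X t =
    sigma_sets (space M) (\<Union>n\<in>{t + 1..}. {X n -` B \<inter> space M | B. B \<in> sets (count_space UNIV)})"

definition tail_sigma :: "'a measure \<Rightarrow> (nat \<Rightarrow> 'a \<Rightarrow> 'b) \<Rightarrow> 'a set set" where
  "tail_sigma M X = (\<Inter>t. future_sigma M X t)"

end

theory Submission
  imports Defs
begin

text \<open>The states form a Markov chain, so the tail is trivial as soon as the chain forgets its state at
  any fixed time: for an event \<open>H\<close> determined by the draws before time \<open>m\<close>, the signed measures
  \<open>P(H, \<xi> n = \<cdot>) - P(H) P(\<xi> n = \<cdot>)\<close> must tend to \<open>0\<close> in total variation as \<open>n\<close> grows
  (lemma \<open>dependence_vanishes\<close>). Then a tail event is independent of every such \<open>H\<close>
  (\<open>tail_indep_past\<close>), hence of itself.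

  Running two copies of the chain with the same draws does not make them meet: two matchings that
  differ in few pairs are brought together only with probability of order \<open>1 / n\<^sup>2\<close> at time \<open>n\<close>.
  The decay is therefore proved in \<open>L\<^sup>2\<close> with respect to the uniform distribution. The key is a
  different description of a pairing step (\<open>pairing_step_pair_sets\<close>): exchange the roles of \<open>v = u2\<close>
  and a uniformly chosen point \<open>z\<close> in the old matching, then break up the pair of \<open>v\<close> and attach the
  two new points. Breaking up pairs loses no information, because the new matching determines \<open>v\<close> and
  the exchanged matching bijectively (\<open>insert_pair_bij\<close>). All forgetting comes from the average over
  \<open>z\<close>, that is, from the operators \<open>A v f p = (1 / n) * (\<Sum>z. f (relabel v z p))\<close> on functions of
  matchings of \<open>n\<close> points.

  It remains to show that, averaged over \<open>v\<close>, the squared norm of \<open>A v f\<close> is smaller than that of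
  a centred \<open>f\<close> by a relative amount of order \<open>1 / n\<close>, since the sum of \<open>1 / n\<close> diverges
  (\<open>star_average_contraction\<close>). As \<open>A v \<ge> - 1 / 2\<close>, one has \<open>A v\<^sup>2 \<le> (1 + A v) / 2\<close>
  (\<open>star_average_square_le\<close>), and the average of \<open>A v\<close> over \<open>v\<close> is the transition operator of the
  random transposition walk on matchings, whose spectral gap is of order \<open>1 / n\<close> (\<open>matchings_spectral_gap\<close>). That gap is obtained
  by induction on the number of points, conditioning on the partner of a random point.\<close>

section \<open>Matchings as fixed-point-free involutions\<close>

text \<open>Values outside \<open>S\<close> are prescribed by \<open>r\<close> instead of being the identity: the matchings of \<open>S\<close>
  that pair \<open>v\<close> with \<open>j\<close> are then literally a set of the same kind (lemma \<open>matchings_on_pairing\<close>),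
  so that inductions on the size of \<open>S\<close> need no transport along bijections.\<close>

definition matchings_on :: "'a set \<Rightarrow> ('a \<Rightarrow> 'a) \<Rightarrow> ('a \<Rightarrow> 'a) set" where
  "matchings_on S r =
    {p. (\<forall>x\<in>S. p x \<in> S \<and> p x \<noteq> x \<and> p (p x) = x) \<and> (\<forall>x. x \<notin> S \<longrightarrow> p x = r x)}"

definition relabel :: "'a \<Rightarrow> 'a \<Rightarrow> ('a \<Rightarrow> 'a) \<Rightarrow> 'a \<Rightarrow> 'a" where
  "relabel a b p = Transposition.transpose a b \<circ> p \<circ> Transposition.transpose a b"

lemma matchings_onD:
  assumes "p \<in> matchings_on S r" "x \<in> S"
  shows "p x \<in> S" "p x \<noteq> x" "p (p x) = x"
  using assms by (auto simp: matchings_on_def)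

lemma matchings_on_eq_iff:
  assumes "p \<in> matchings_on S r" "x \<in> S" "y \<in> S"
  shows "p x = y \<longleftrightarrow> x = p y"
  using assms by (auto simp: matchings_on_def)

lemma finite_matchings_on: "finite S \<Longrightarrow> finite (matchings_on S r)"
proof -
  assume fin: "finite S"
  have "matchings_on S r \<subseteq> (\<lambda>g x. if x \<in> S then g x else r x) ` (S \<rightarrow>\<^sub>E S)"
  proof
    fix p assume p: "p \<in> matchings_on S r"
    have "p = (\<lambda>x. if x \<in> S then (restrict p S) x else r x)"
      using p by (auto simp: matchings_on_def fun_eq_iff)
    moreover have "restrict p S \<in> S \<rightarrow>\<^sub>E S"
      using p by (auto simp: matchings_on_def)
    ultimately show "p \<in> (\<lambda>g x. if x \<in> S then g x else r x) ` (S \<rightarrow>\<^sub>E S)"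
      by blast
  qed
  then show ?thesis
    using fin by (meson finite_PiE finite_imageI finite_subset)
qed

lemma matchings_on_pairing:
  assumes "v \<in> S" "j \<in> S" "v \<noteq> j"
  shows "{p \<in> matchings_on S r. p v = j} = matchings_on (S - {v, j}) (r(v := j, j := v))"
proof (intro set_eqI iffI)
  fix p assume "p \<in> {p \<in> matchings_on S r. p v = j}"
  then have p: "p \<in> matchings_on S r" "p v = j" by auto
  have "p j = v" using p assms by (auto simp: matchings_on_def)
  moreover have "p x \<noteq> v \<and> p x \<noteq> j" if "x \<in> S - {v, j}" for x
    using p that \<open>p j = v\<close> assms by (auto simp: matchings_on_def)
  ultimately show "p \<in> matchings_on (S - {v, j}) (r(v := j, j := v))"
    using p assms by (auto simp: matchings_on_def)
next
  fix p assume p: "p \<in> matchings_on (S - {v, j}) (r(v := j, j := v))"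
  have out: "p x = (r(v := j, j := v)) x" if "x \<notin> S - {v, j}" for x
    using p that unfolding matchings_on_def by blast
  have pv: "p v = j" "p j = v" using out[of v] out[of j] assms by auto
  have "p x \<in> S \<and> p x \<noteq> x \<and> p (p x) = x" if "x \<in> S" for x
  proof (cases "x \<in> {v, j}")
    case False
    then have "x \<in> S - {v, j}" using that by simp
    then show ?thesis using matchings_onD[OF p] by blast
  qed (use pv assms in auto)
  moreover have "p x = r x" if "x \<notin> S" for x
  proof -
    have "x \<noteq> v" "x \<noteq> j" using that assms by auto
    then show ?thesis using out[of x] that by simp
  qed
  ultimately have "p \<in> matchings_on S r" unfolding matchings_on_def by blast
  then show "p \<in> {p \<in> matchings_on S r. p v = j}" using pv by simp
qed

lemma relabel_same [simp]: "relabel a a p = p"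
  by (simp add: relabel_def)

lemma relabel_relabel [simp]: "relabel a b (relabel a b p) = p"
  by (simp add: relabel_def fun_eq_iff)

lemma relabel_commute: "relabel a b p = relabel b a p"
  by (simp add: relabel_def transpose_commute)

lemma relabel_partner:
  assumes "r ` (- S) \<subseteq> - S" "p \<in> matchings_on S r" "a \<in> S"
  shows "relabel a (p a) p = p"
proof
  fix x
  note pa = matchings_onD[OF assms(2,3)]
  have "p x \<noteq> a \<and> p x \<noteq> p a" if "x \<noteq> a" "x \<noteq> p a"
  proof (cases "x \<in> S")
    case True
    then show ?thesis using matchings_onD[OF assms(2) True] pa that by metis
  next
    case False
    then have "p x \<notin> S" using assms by (auto simp: matchings_on_def)
    then show ?thesis using assms(3) pa by metis
  qed
  then show "relabel a (p a) p x = p x"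
    using pa by (cases "x = a \<or> x = p a") (auto simp: relabel_def)
qed

lemma relabel_in:
  assumes "r ` (- S) \<subseteq> - S" "a \<in> S" "b \<in> S" "p \<in> matchings_on S r"
  shows "relabel a b p \<in> matchings_on S r"
proof -
  have t: "Transposition.transpose a b x \<in> S \<longleftrightarrow> x \<in> S" for x
    using assms by (auto simp: Transposition.transpose_def)
  have "relabel a b p x \<in> S \<and> relabel a b p x \<noteq> x \<and> relabel a b p (relabel a b p x) = x"
    if "x \<in> S" for x
  proof -
    have x': "Transposition.transpose a b x \<in> S" using that t by simp
    note px = matchings_onD[OF assms(4) x']
    show ?thesis
      using px t by (auto simp: relabel_def) (metis px(2) transpose_involutory)
  qed
  moreover have "relabel a b p x = r x" if "x \<notin> S" for x
  proof -
    have "r x \<notin> S" using that assms(1) by auto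
    then have "x \<noteq> a" "x \<noteq> b" "r x \<noteq> a" "r x \<noteq> b" using that assms(2,3) by auto
    then show ?thesis using that assms(4) by (simp add: relabel_def matchings_on_def)
  qed
  ultimately show ?thesis by (simp add: matchings_on_def)
qed

lemma sum_relabel:
  assumes "r ` (- S) \<subseteq> - S" "a \<in> S" "b \<in> S"
  shows "(\<Sum>p\<in>matchings_on S r. g (relabel a b p)) = (\<Sum>p\<in>matchings_on S r. g p)"
  by (rule sum.reindex_bij_witness[of _ "relabel a b" "relabel a b"])
     (use relabel_in[OF assms] in auto)

section \<open>Spectral gap of the random transposition walk on matchings\<close>

abbreviation jump :: "(('a \<Rightarrow> 'a) \<Rightarrow> real) \<Rightarrow> ('a \<Rightarrow> 'a) \<Rightarrow> 'a \<Rightarrow> 'a \<Rightarrow> real" where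
  "jump f p a b \<equiv> (f p - f (relabel a b p))\<^sup>2"

definition dirichlet :: "'a set \<Rightarrow> ('a \<Rightarrow> 'a) \<Rightarrow> (('a \<Rightarrow> 'a) \<Rightarrow> real) \<Rightarrow> real" where
  "dirichlet S r f = (\<Sum>p\<in>matchings_on S r. \<Sum>a\<in>S. \<Sum>b\<in>S. jump f p a b)"

lemma sum_pair_diff_squares:
  fixes s :: "'b \<Rightarrow> real"
  assumes "finite J" "(\<Sum>j\<in>J. s j) = 0"
  shows "(\<Sum>j\<in>J. \<Sum>z\<in>J. (s j - s z)\<^sup>2) = 2 * real (card J) * (\<Sum>j\<in>J. (s j)\<^sup>2)"
proof -
  have "(\<Sum>j\<in>J. \<Sum>z\<in>J. (s j - s z)\<^sup>2) =
      (\<Sum>j\<in>J. \<Sum>z\<in>J. (s j)\<^sup>2 + (s z)\<^sup>2 - 2 * (s j * s z))"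
    by (simp add: power2_diff mult.assoc)
  also have "\<dots> = 2 * real (card J) * (\<Sum>j\<in>J. (s j)\<^sup>2) - 2 * (\<Sum>j\<in>J. \<Sum>z\<in>J. s j * s z)"
    by (simp add: sum.distrib sum_subtractf sum_distrib_left[symmetric] sum_distrib_right[symmetric])
  also have "(\<Sum>j\<in>J. \<Sum>z\<in>J. s j * s z) = 0"
    using assms(2) by (simp add: sum_distrib_left[symmetric])
  finally show ?thesis by simp
qed

lemma sum_squared_le_card:
  fixes g :: "'b \<Rightarrow> real"
  shows "(\<Sum>x\<in>X. g x)\<^sup>2 \<le> real (card X) * (\<Sum>x\<in>X. (g x)\<^sup>2)"
  using Cauchy_Schwarz_ineq_sum[of "\<lambda>_. 1" g X] by simp

lemma sum_squares_centred:
  fixes g :: "'b \<Rightarrow> real"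
  assumes "finite X" "X \<noteq> {}"
  shows "real (card X) * (\<Sum>x\<in>X. (g x)\<^sup>2) =
    real (card X) * (\<Sum>x\<in>X. (g x - (\<Sum>x\<in>X. g x) / card X)\<^sup>2) + (\<Sum>x\<in>X. g x)\<^sup>2"
proof -
  let ?s = "\<Sum>x\<in>X. g x" and ?m = "real (card X)"
  have m: "?m \<noteq> 0" using assms by simp
  define t where "t = ?s / ?m"
  have "(\<Sum>x\<in>X. (g x - t)\<^sup>2) = (\<Sum>x\<in>X. (g x)\<^sup>2 - 2 * t * g x + t\<^sup>2)"
    by (simp add: power2_diff algebra_simps)
  also have "\<dots> = (\<Sum>x\<in>X. (g x)\<^sup>2) - 2 * t * ?s + ?m * t\<^sup>2"
    by (simp only: sum.distrib sum_subtractf sum_distrib_left[symmetric] sum_constant)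
  finally have "?m * (\<Sum>x\<in>X. (g x - t)\<^sup>2) = ?m * ((\<Sum>x\<in>X. (g x)\<^sup>2) - 2 * t * ?s + ?m * t\<^sup>2)"
    by simp
  also have "\<dots> = ?m * (\<Sum>x\<in>X. (g x)\<^sup>2) - ?s\<^sup>2"
    using m by (simp add: t_def field_simps power2_eq_square)
  finally show ?thesis by (simp add: t_def)
qed

text \<open>Relabelling \<open>j\<close> as \<open>z\<close> moves the matchings with \<open>v\<close> paired to \<open>j\<close> bijectively onto those with
  \<open>v\<close> paired to \<open>z\<close>. Hence the classes have equal size, and by the Cauchy-Schwarz inequality the
  differences of their sums are controlled by the jumps between them.\<close>

lemma relabel_class_bij:
  assumes "r ` (- S) \<subseteq> - S" "v \<in> S" "j \<in> S - {v}" "z \<in> S - {v}"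
  shows "bij_betw (relabel j z) {p \<in> matchings_on S r. p v = j} {p \<in> matchings_on S r. p v = z}"
proof (rule bij_betw_byWitness[where f' = "relabel j z"])
  have r: "relabel a b p \<in> {p \<in> matchings_on S r. p v = b}"
    if "a \<in> S - {v}" "b \<in> S - {v}" "p \<in> {p \<in> matchings_on S r. p v = a}" for a b p
    using that assms(2) relabel_in[OF assms(1), of a b p] by (auto simp: relabel_def)
  show "relabel j z ` {p \<in> matchings_on S r. p v = j} \<subseteq> {p \<in> matchings_on S r. p v = z}"
    using r[OF assms(3,4)] by blast
  show "relabel j z ` {p \<in> matchings_on S r. p v = z} \<subseteq> {p \<in> matchings_on S r. p v = j}"
    using r[OF assms(4,3)] by (auto simp: relabel_commute[of j z])
qed auto

lemma sum_by_partner: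
  fixes g :: "('a \<Rightarrow> 'a) \<Rightarrow> real"
  assumes "finite S" "v \<in> S"
  shows "(\<Sum>p\<in>matchings_on S r. g p) =
    (\<Sum>j\<in>S - {v}. \<Sum>p\<in>{p \<in> matchings_on S r. p v = j}. g p)"
  by (rule sum.group[symmetric]) (use assms finite_matchings_on[of S r] in \<open>auto dest: matchings_onD\<close>)

text \<open>Variance decomposition with respect to the partner of \<open>v\<close>: the variance within the classes is
  bounded through the inverse gap \<open>c\<close> of the smaller matchings, the variance between the classes by the jumps
  that move the partner of \<open>v\<close>.\<close>

lemma conditional_variance_bound:
  assumes fin: "finite S" and st: "r ` (- S) \<subseteq> - S" and v: "v \<in> S"
    and card: "card S \<ge> 2" and c: "c \<ge> 0"
    and mean: "(\<Sum>p\<in>matchings_on S r. f p) = 0"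
    and smaller: "\<And>j g. j \<in> S - {v} \<Longrightarrow>
      (\<Sum>p\<in>{p \<in> matchings_on S r. p v = j}. g p) = 0 \<Longrightarrow>
      (\<Sum>p\<in>{p \<in> matchings_on S r. p v = j}. (g p)\<^sup>2) \<le>
      c * (\<Sum>p\<in>{p \<in> matchings_on S r. p v = j}. \<Sum>a\<in>S - {v, j}. \<Sum>b\<in>S - {v, j}. jump g p a b)"
  shows "(\<Sum>p\<in>matchings_on S r. (f p)\<^sup>2) \<le>
    c * (\<Sum>p\<in>matchings_on S r. \<Sum>a\<in>S - {v, p v}. \<Sum>b\<in>S - {v, p v}. jump f p a b) +
    (\<Sum>p\<in>matchings_on S r. \<Sum>z\<in>S - {v}. jump f p (p v) z) / (2 * (real (card S) - 1))"
proof (cases "matchings_on S r = {}")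
  case False
  let ?C = "\<lambda>j. {p \<in> matchings_on S r. p v = j}"
  let ?J = "S - {v}"
  define s where "s j = (\<Sum>p\<in>?C j. f p)" for j
  obtain p0 where p0: "p0 \<in> matchings_on S r" using False by blast
  define m where "m = card (?C (p0 v))"
  have p0v: "p0 v \<in> ?J" using matchings_onD[OF p0 v] by auto
  have finC: "finite (?C j)" for j using finite_matchings_on[OF fin] by auto
  have m0: "m > 0" using p0 finC by (auto simp: m_def card_gt_0_iff)
  have cardC: "card (?C j) = m" if "j \<in> ?J" for j
    using bij_betw_same_card[OF relabel_class_bij[OF st v that p0v]] by (simp add: m_def)
  have neC: "?C j \<noteq> {}" if "j \<in> ?J" for j using cardC[OF that] m0 by (metis card.empty less_irrefl)
  have cardJ: "real (card ?J) = real (card S) - 1"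
    using fin v card by (simp add: card_Diff_singleton)
  have "(\<Sum>j\<in>?J. s j) = 0"
    using sum_by_partner[OF fin v, of f r] mean by (simp add: s_def)
  then have S2: "(\<Sum>j\<in>?J. \<Sum>z\<in>?J. (s j - s z)\<^sup>2) = 2 * (real (card S) - 1) * (\<Sum>j\<in>?J. (s j)\<^sup>2)"
    using sum_pair_diff_squares[of ?J s] fin cardJ by simp
  have diff: "(s j - s z)\<^sup>2 \<le> m * (\<Sum>p\<in>?C j. jump f p j z)" if "j \<in> ?J" "z \<in> ?J" for j z
  proof -
    have "s z = (\<Sum>p\<in>?C j. f (relabel j z p))"
      unfolding s_def by (rule sum.reindex_bij_betw[symmetric, OF relabel_class_bij[OF st v that]])
    then have "s j - s z = (\<Sum>p\<in>?C j. f p - f (relabel j z p))"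
      by (simp add: s_def sum_subtractf)
    then show ?thesis
      using sum_squared_le_card[of "\<lambda>p. f p - f (relabel j z p)" "?C j"] cardC[OF that(1)] by simp
  qed
  have between: "2 * (real (card S) - 1) * (\<Sum>j\<in>?J. (s j)\<^sup>2) \<le>
      m * (\<Sum>p\<in>matchings_on S r. \<Sum>z\<in>?J. jump f p (p v) z)"
  proof -
    have "(\<Sum>j\<in>?J. \<Sum>z\<in>?J. (s j - s z)\<^sup>2) \<le> (\<Sum>j\<in>?J. \<Sum>z\<in>?J. m * (\<Sum>p\<in>?C j. jump f p j z))"
      by (intro sum_mono diff)
    also have "\<dots> = m * (\<Sum>j\<in>?J. \<Sum>z\<in>?J. \<Sum>p\<in>?C j. jump f p j z)"
      by (simp only: sum_distrib_left)
    also have "(\<Sum>j\<in>?J. \<Sum>z\<in>?J. \<Sum>p\<in>?C j. jump f p j z) =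
        (\<Sum>j\<in>?J. \<Sum>p\<in>?C j. \<Sum>z\<in>?J. jump f p j z)"
      by (rule sum.cong[OF refl], rule sum.swap)
    also have "(\<Sum>j\<in>?J. \<Sum>p\<in>?C j. \<Sum>z\<in>?J. jump f p j z) =
        (\<Sum>j\<in>?J. \<Sum>p\<in>?C j. \<Sum>z\<in>?J. jump f p (p v) z)"
      by (intro sum.cong) auto
    also have "\<dots> = (\<Sum>p\<in>matchings_on S r. \<Sum>z\<in>?J. jump f p (p v) z)"
      by (rule sum_by_partner[OF fin v, symmetric])
    finally show ?thesis using S2 by simp
  qed
  have within: "(\<Sum>p\<in>?C j. (f p)\<^sup>2) \<le>
      c * (\<Sum>p\<in>?C j. \<Sum>a\<in>S - {v, p v}. \<Sum>b\<in>S - {v, p v}. jump f p a b) + (s j)\<^sup>2 / m"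
    if "j \<in> ?J" for j
  proof -
    let ?g = "\<lambda>p. f p - s j / m"
    have "(\<Sum>p\<in>?C j. ?g p) = 0"
      using cardC[OF that] m0 by (simp add: sum_subtractf s_def)
    from smaller[OF that this]
    have "(\<Sum>p\<in>?C j. (?g p)\<^sup>2) \<le>
        c * (\<Sum>p\<in>?C j. \<Sum>a\<in>S - {v, j}. \<Sum>b\<in>S - {v, j}. jump f p a b)" by simp
    also have "(\<Sum>p\<in>?C j. \<Sum>a\<in>S - {v, j}. \<Sum>b\<in>S - {v, j}. jump f p a b) =
        (\<Sum>p\<in>?C j. \<Sum>a\<in>S - {v, p v}. \<Sum>b\<in>S - {v, p v}. jump f p a b)"
      by (intro sum.cong) auto
    finally have "(\<Sum>p\<in>?C j. (?g p)\<^sup>2) \<le>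
        c * (\<Sum>p\<in>?C j. \<Sum>a\<in>S - {v, p v}. \<Sum>b\<in>S - {v, p v}. jump f p a b)" .
    moreover have "(\<Sum>p\<in>?C j. (f p)\<^sup>2) = (\<Sum>p\<in>?C j. (?g p)\<^sup>2) + (s j)\<^sup>2 / m"
    proof -
      have "m * (\<Sum>p\<in>?C j. (f p)\<^sup>2) = m * (\<Sum>p\<in>?C j. (?g p)\<^sup>2) + (s j)\<^sup>2"
        using sum_squares_centred[OF finC neC[OF that], of f]
        unfolding cardC[OF that] s_def .
      also have "\<dots> = m * ((\<Sum>p\<in>?C j. (?g p)\<^sup>2) + (s j)\<^sup>2 / m)"
        using m0 by (simp only: distrib_left) simp
      finally show ?thesis using m0 by (simp only: mult_cancel_left) simp
    qed
    ultimately show ?thesis by linarith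
  qed
  have "(\<Sum>p\<in>matchings_on S r. (f p)\<^sup>2) = (\<Sum>j\<in>?J. \<Sum>p\<in>?C j. (f p)\<^sup>2)"
    by (rule sum_by_partner[OF fin v])
  also have "\<dots> \<le> (\<Sum>j\<in>?J. c * (\<Sum>p\<in>?C j. \<Sum>a\<in>S - {v, p v}. \<Sum>b\<in>S - {v, p v}. jump f p a b)
      + (s j)\<^sup>2 / m)"
    by (intro sum_mono within)
  also have "\<dots> = c * (\<Sum>p\<in>matchings_on S r. \<Sum>a\<in>S - {v, p v}. \<Sum>b\<in>S - {v, p v}. jump f p a b)
      + (\<Sum>j\<in>?J. (s j)\<^sup>2) / m"
    by (simp only: sum.distrib sum_distrib_left[symmetric] sum_divide_distrib[symmetric]
        sum_by_partner[OF fin v])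
  also have "(\<Sum>j\<in>?J. (s j)\<^sup>2) / m \<le>
      (\<Sum>p\<in>matchings_on S r. \<Sum>z\<in>?J. jump f p (p v) z) / (2 * (real (card S) - 1))"
    using between m0 card by (simp add: field_simps)
  finally show ?thesis by simp
qed simp

text \<open>The four points \<open>a\<close>, \<open>b\<close> and their partners are distinct whenever \<open>relabel a b p\<close> differs from
  \<open>p\<close>, so a jump survives conditioning on the pair of \<open>v\<close> for all but four choices of \<open>v\<close>.\<close>

lemma sum_surviving_jumps:
  assumes fin: "finite S" and st: "r ` (- S) \<subseteq> - S" and p: "p \<in> matchings_on S r"
  shows "(\<Sum>v\<in>S. \<Sum>a\<in>S - {v, p v}. \<Sum>b\<in>S - {v, p v}. jump f p a b) \<le>
    (real (card S) - 4) * (\<Sum>a\<in>S. \<Sum>b\<in>S. jump f p a b)"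
proof -
  let ?ok = "\<lambda>a b. {v \<in> S. v \<notin> {a, b} \<and> p v \<notin> {a, b}}"
  have "(\<Sum>v\<in>S. \<Sum>a\<in>S - {v, p v}. \<Sum>b\<in>S - {v, p v}. jump f p a b) =
      (\<Sum>v\<in>S. \<Sum>a\<in>S. \<Sum>b\<in>S. if v \<in> ?ok a b then jump f p a b else 0)"
  proof (rule sum.cong[OF refl])
    fix v assume v: "v \<in> S"
    have "(\<Sum>a\<in>S. \<Sum>b\<in>S. if v \<in> ?ok a b then jump f p a b else 0) =
        (\<Sum>a\<in>S. if a \<in> S - {v, p v} then
          (\<Sum>b\<in>S. if b \<in> S - {v, p v} then jump f p a b else 0) else 0)"
      by (intro sum.cong refl) (auto simp: v intro!: sum.neutral sum.cong)
    also have "\<dots> = (\<Sum>a\<in>S - {v, p v}. \<Sum>b\<in>S - {v, p v}. jump f p a b)"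
      by (subst (1 2) sum.inter_restrict[OF fin, symmetric]) (simp add: Int_absorb1)
    finally show "(\<Sum>a\<in>S - {v, p v}. \<Sum>b\<in>S - {v, p v}. jump f p a b) =
      (\<Sum>a\<in>S. \<Sum>b\<in>S. if v \<in> ?ok a b then jump f p a b else 0)" by simp
  qed
  also have "\<dots> = (\<Sum>a\<in>S. \<Sum>b\<in>S. \<Sum>v\<in>S. if v \<in> ?ok a b then jump f p a b else 0)"
    by (rule trans[OF sum.swap], rule sum.cong[OF refl], rule sum.swap)
  also have "\<dots> = (\<Sum>a\<in>S. \<Sum>b\<in>S. real (card (?ok a b)) * jump f p a b)"
  proof (rule sum.cong[OF refl], rule sum.cong[OF refl])
    fix a b
    have "(\<Sum>v\<in>S. if v \<in> ?ok a b then jump f p a b else 0) = (\<Sum>v\<in>S \<inter> ?ok a b. jump f p a b)"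
      by (rule sum.inter_restrict[OF fin, symmetric])
    also have "S \<inter> ?ok a b = ?ok a b" by blast
    finally show "(\<Sum>v\<in>S. if v \<in> ?ok a b then jump f p a b else 0) =
      real (card (?ok a b)) * jump f p a b" by simp
  qed
  also have "\<dots> \<le> (\<Sum>a\<in>S. \<Sum>b\<in>S. (real (card S) - 4) * jump f p a b)"
  proof (intro sum_mono)
    fix a b assume ab: "a \<in> S" "b \<in> S"
    show "real (card (?ok a b)) * jump f p a b \<le> (real (card S) - 4) * jump f p a b"
    proof (cases "a = b \<or> b = p a")
      case True
      then show ?thesis using relabel_partner[OF st p ab(1)] by auto
    next
      case False
      let ?Q = "{a, b, p a, p b}"
      note pa = matchings_onD[OF p ab(1)] and pb = matchings_onD[OF p ab(2)]
      have "p a \<noteq> p b" using pa pb False by metis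
      moreover have "p b \<noteq> a" using pb False by auto
      ultimately have "card ?Q = 4" using False pa pb by auto
      moreover have Q: "?Q \<subseteq> S" using ab pa pb by auto
      moreover have "?ok a b = S - ?Q"
      proof -
        have "p v = a \<longleftrightarrow> v = p a" "p v = b \<longleftrightarrow> v = p b" if "v \<in> S" for v
          using matchings_on_eq_iff[OF p that] ab by simp_all
        then show ?thesis by auto
      qed
      ultimately have "card (?ok a b) = card S - 4" "card S \<ge> 4"
        using fin card_mono[OF fin Q] by (auto simp: card_Diff_subset finite_subset)
      then show ?thesis by simp
    qed
  qed
  finally show ?thesis by (simp add: sum_distrib_left)
qed

text \<open>Averaging the variance decomposition over all \<open>v\<close> gives, with \<open>n = card S\<close>,
  the recursion \<open>n * G n \<le> (n - 4) * G (n - 2) + 1 / (2 * (n - 1))\<close> for the inverse gap \<open>G\<close>, which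
  \<open>1 / (4 * n)\<close> solves. What matters below is the order: a gap of order \<open>n\<close> in this
  unnormalised form, i.e. of order \<open>1 / n\<close> for the walk.\<close>

theorem matchings_spectral_gap:
  assumes "finite S" "card S = 2 * k" "r ` (- S) \<subseteq> - S" "(\<Sum>p\<in>matchings_on S r. f p) = 0"
  shows "4 * real (card S) * (\<Sum>p\<in>matchings_on S r. (f p)\<^sup>2) \<le> dirichlet S r f"
  using assms
proof (induction k arbitrary: S r f)
  case 0
  then show ?case by (simp add: dirichlet_def)
next
  case (Suc k)
  note fin = Suc.prems(1) and st = Suc.prems(3) and mean = Suc.prems(4)
  let ?n = "real (card S)" and ?M = "matchings_on S r"
  show ?case
  proof (cases "k = 0")
    case True
    then obtain v w where S: "S = {v, w}" "v \<noteq> w"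
      using Suc.prems(2) by (auto simp: card_2_iff)
    have "p = q" if "p \<in> ?M" "q \<in> ?M" for p q
    proof
      fix x
      have two: "q' v = w" "q' w = v" if "q' \<in> ?M" for q'
        using matchings_onD[OF that, of v] matchings_onD[OF that, of w] S by auto
      show "p x = q x"
        using two[OF that(1)] two[OF that(2)] that S by (cases "x \<in> S") (auto simp: matchings_on_def)
    qed
    then obtain q where "?M \<subseteq> {q}" by blast
    then have "?M = {} \<or> ?M = {q}" by blast
    then have "(\<Sum>p\<in>?M. (f p)\<^sup>2) = 0" using mean by auto
    then show ?thesis by (simp add: dirichlet_def sum_nonneg)
  next
    case False
    have n: "?n = 2 * real k + 2" "k \<ge> 1" using Suc.prems(2) False by auto
    let ?c = "1 / (4 * (?n - 2))"
    let ?I = "\<lambda>v. \<Sum>p\<in>?M. \<Sum>a\<in>S - {v, p v}. \<Sum>b\<in>S - {v, p v}. jump f p a b"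
    let ?B = "\<lambda>v. \<Sum>p\<in>?M. \<Sum>z\<in>S - {v}. jump f p (p v) z"
    let ?D = "dirichlet S r f"
    have each: "(\<Sum>p\<in>?M. (f p)\<^sup>2) \<le> ?c * ?I v + ?B v / (2 * (?n - 1))" if v: "v \<in> S" for v
    proof (rule conditional_variance_bound[OF fin st v _ _ mean])
      show "card S \<ge> 2" using Suc.prems(2) by simp
      show "?c \<ge> 0" using n by simp
      fix j and g :: "('a \<Rightarrow> 'a) \<Rightarrow> real"
      let ?C = "{p \<in> ?M. p v = j}"
      assume j: "j \<in> S - {v}" and g: "(\<Sum>p\<in>?C. g p) = 0"
      let ?S = "S - {v, j}" and ?r = "r(v := j, j := v)"
      have C: "?C = matchings_on ?S ?r" using matchings_on_pairing[of v S j r] v j by auto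
      have card': "card ?S = 2 * k"
        using fin v j Suc.prems(2) by (subst card_Diff_subset) auto
      have "4 * real (card ?S) * (\<Sum>p\<in>?C. (g p)\<^sup>2) \<le> dirichlet ?S ?r g"
        unfolding C
      proof (rule Suc.IH)
        show "finite ?S" using fin by simp
        show "card ?S = 2 * k" by (rule card')
        show "?r ` (- ?S) \<subseteq> - ?S" using st by auto
        show "(\<Sum>p\<in>matchings_on ?S ?r. g p) = 0" using g by (simp add: C)
      qed
      then show "(\<Sum>p\<in>?C. (g p)\<^sup>2) \<le> ?c * (\<Sum>p\<in>?C. \<Sum>a\<in>?S. \<Sum>b\<in>?S. jump g p a b)"
        using n card' by (simp add: dirichlet_def C field_simps)
    qed
    have I: "(\<Sum>v\<in>S. ?I v) \<le> (?n - 4) * ?D"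
      unfolding dirichlet_def sum_distrib_left
      by (subst sum.swap) (intro sum_mono order_trans[OF sum_surviving_jumps[OF fin st]],
          auto simp: sum_distrib_left)
    have B: "(\<Sum>v\<in>S. ?B v) \<le> ?D"
      unfolding dirichlet_def
    proof (subst sum.swap, rule sum_mono)
      fix p assume p: "p \<in> ?M"
      have "(\<Sum>v\<in>S. \<Sum>z\<in>S - {v}. jump f p (p v) z) \<le> (\<Sum>v\<in>S. \<Sum>z\<in>S. jump f p (p v) z)"
        using fin by (intro sum_mono sum_mono2) auto
      also have "\<dots> = (\<Sum>a\<in>S. \<Sum>z\<in>S. jump f p a z)"
        by (rule sum.reindex_bij_witness[of _ p p]) (use matchings_onD[OF p] in auto)
      finally show "(\<Sum>v\<in>S. \<Sum>z\<in>S - {v}. jump f p (p v) z) \<le> (\<Sum>a\<in>S. \<Sum>z\<in>S. jump f p a z)" .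
    qed
    have D0: "?D \<ge> 0" by (simp add: dirichlet_def sum_nonneg)
    have "?n * (\<Sum>p\<in>?M. (f p)\<^sup>2) = (\<Sum>v\<in>S. \<Sum>p\<in>?M. (f p)\<^sup>2)" by simp
    also have "\<dots> \<le> (\<Sum>v\<in>S. ?c * ?I v + ?B v / (2 * (?n - 1)))" by (intro sum_mono each)
    also have "\<dots> = ?c * (\<Sum>v\<in>S. ?I v) + (\<Sum>v\<in>S. ?B v) / (2 * (?n - 1))"
      by (simp only: sum.distrib sum_distrib_left[symmetric] sum_divide_distrib[symmetric])
    also have "\<dots> \<le> ?c * ((?n - 4) * ?D) + ?D / (2 * (?n - 1))"
      using I B n by (intro add_mono mult_left_mono divide_right_mono) auto
    also have "\<dots> = (?c * (?n - 4) + 1 / (2 * (?n - 1))) * ?D"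
      by (simp only: distrib_right mult.assoc times_divide_eq_left mult_1)
    also have "\<dots> \<le> 1 / 4 * ?D"
    proof (rule mult_right_mono[OF _ D0])
      show "?c * (?n - 4) + 1 / (2 * (?n - 1)) \<le> 1 / 4"
        using n by (simp add: divide_simps) (simp add: algebra_simps)
    qed
    finally show ?thesis by simp
  qed
qed

section \<open>Contraction of the star averages\<close>

definition star_average :: "'a set \<Rightarrow> 'a \<Rightarrow> (('a \<Rightarrow> 'a) \<Rightarrow> real) \<Rightarrow> ('a \<Rightarrow> 'a) \<Rightarrow> real" where
  "star_average S v f p = (\<Sum>z\<in>S. f (relabel v z p)) / card S"

lemma star_average_self_adjoint:
  assumes "r ` (- S) \<subseteq> - S" "v \<in> S"
  shows "(\<Sum>p\<in>matchings_on S r. f p * star_average S v g p) =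
    (\<Sum>p\<in>matchings_on S r. star_average S v f p * g p)"
proof -
  have "(\<Sum>p\<in>matchings_on S r. f p * star_average S v g p) =
      (\<Sum>z\<in>S. \<Sum>p\<in>matchings_on S r. f p * g (relabel v z p)) / card S"
    by (subst sum.swap) (simp add: star_average_def sum_distrib_left sum_divide_distrib)
  also have "(\<Sum>z\<in>S. \<Sum>p\<in>matchings_on S r. f p * g (relabel v z p)) =
      (\<Sum>z\<in>S. \<Sum>p\<in>matchings_on S r. f (relabel v z p) * g p)"
  proof (rule sum.cong[OF refl])
    fix z assume "z \<in> S"
    then show "(\<Sum>p\<in>matchings_on S r. f p * g (relabel v z p)) =
        (\<Sum>p\<in>matchings_on S r. f (relabel v z p) * g p)"
      using sum_relabel[OF assms, of z "\<lambda>p. f (relabel v z p) * g p"] by simp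
  qed
  also have "\<dots> / card S = (\<Sum>p\<in>matchings_on S r. star_average S v f p * g p)"
    by (subst sum.swap) (simp add: star_average_def sum_distrib_right sum_divide_distrib)
  finally show ?thesis .
qed

lemma star_average_energy:
  assumes fin: "finite S" and st: "r ` (- S) \<subseteq> - S" and v: "v \<in> S"
  shows "(\<Sum>p\<in>matchings_on S r. \<Sum>z\<in>S. jump f p v z) =
    2 * real (card S) * ((\<Sum>p\<in>matchings_on S r. (f p)\<^sup>2) -
      (\<Sum>p\<in>matchings_on S r. f p * star_average S v f p))"
proof -
  let ?M = "matchings_on S r"
  have n: "real (card S) > 0" using fin v by (auto simp: card_gt_0_iff)
  have "(\<Sum>p\<in>?M. \<Sum>z\<in>S. jump f p v z) =
      (\<Sum>z\<in>S. \<Sum>p\<in>?M. (f p)\<^sup>2 + (f (relabel v z p))\<^sup>2 - 2 * (f p * f (relabel v z p)))"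
    by (subst sum.swap) (simp add: power2_diff mult.assoc)
  also have "\<dots> = (\<Sum>z\<in>S. 2 * (\<Sum>p\<in>?M. (f p)\<^sup>2) - 2 * (\<Sum>p\<in>?M. f p * f (relabel v z p)))"
    using sum_relabel[OF st v, of _ "\<lambda>p. (f p)\<^sup>2"]
    by (intro sum.cong refl) (simp add: sum.distrib sum_subtractf sum_distrib_left)
  also have "\<dots> = 2 * real (card S) * (\<Sum>p\<in>?M. (f p)\<^sup>2) -
      2 * (\<Sum>z\<in>S. \<Sum>p\<in>?M. f p * f (relabel v z p))"
    unfolding sum_subtractf sum_distrib_left[symmetric] by simp
  also have "(\<Sum>z\<in>S. \<Sum>p\<in>?M. f p * f (relabel v z p)) =
      real (card S) * (\<Sum>p\<in>?M. f p * star_average S v f p)"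
    unfolding sum_distrib_left using n
    by (subst sum.swap) (intro sum.cong refl, simp add: star_average_def sum_distrib_left[symmetric])
  finally show ?thesis by (simp add: algebra_simps)
qed

text \<open>On pairs of a matching and a point \<open>z\<close>, switching \<open>v\<close> with \<open>z\<close> and renaming \<open>z\<close> to its partner
  are involutions that generate the symmetric group of the three matchings of \<open>v\<close>, \<open>p v\<close>, \<open>z\<close>, \<open>p z\<close>.
  The equation is their braid relation.\<close>

lemma relabel_braid:
  assumes st: "r ` (- S) \<subseteq> - S" and p: "p \<in> matchings_on S r"
    and v: "v \<in> S" and z: "z \<in> S" "z \<noteq> v" "p v \<noteq> z"
  shows "relabel v (relabel v z p z) (relabel v z p) = relabel v (p z) p"
proof
  fix x
  note pv = matchings_onD[OF p v] and pz = matchings_onD[OF p z(1)]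
  have d: "p z \<noteq> v" "p z \<noteq> p v" using pv pz z by metis+
  have px: "p x \<noteq> v \<and> p x \<noteq> z \<and> p x \<noteq> p v \<and> p x \<noteq> p z" if "x \<notin> {v, z, p v, p z}"
  proof (cases "x \<in> S")
    case True
    then show ?thesis using matchings_onD[OF p True] pv pz that by (metis insertCI)
  next
    case False
    then have "p x \<notin> S" using p st by (auto simp: matchings_on_def)
    then show ?thesis using v z pv pz by metis
  qed
  have "relabel v z p z = p v" using z pv d by (simp add: relabel_def)
  moreover have "relabel v (p v) (relabel v z p) x = relabel v (p z) p x"
  proof (cases "x \<in> {v, z, p v, p z}")
    case True
    then show ?thesis
      using pv pz z d by (auto simp: relabel_def Transposition.transpose_def)
  next
    case False
    then show ?thesis using px by (simp add: relabel_def)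
  qed
  ultimately show "relabel v (relabel v z p z) (relabel v z p) x = relabel v (p z) p x" by simp
qed

text \<open>The switches involving \<open>v\<close> act on the three matchings of four points as the complete graph,
  and \<open>2 * (x * y + y * w + w * x) \<ge> - (x\<^sup>2 + y\<^sup>2 + w\<^sup>2)\<close>. This rules out a parity obstruction:
  on functions of permutations the analogous average multiplies the sign by almost \<open>-1\<close>.\<close>

lemma star_average_ge_neg_half:
  assumes fin: "finite S" and st: "r ` (- S) \<subseteq> - S" and v: "v \<in> S"
  shows "(\<Sum>p\<in>matchings_on S r. f p * star_average S v f p) \<ge>
    - (\<Sum>p\<in>matchings_on S r. (f p)\<^sup>2) / 2"
proof -
  let ?M = "matchings_on S r"
  let ?N = "\<Sum>p\<in>?M. (f p)\<^sup>2"
  have n: "real (card S) > 0" using fin v by (auto simp: card_gt_0_iff)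
  have finM: "finite ?M" by (rule finite_matchings_on[OF fin])
  \<comment> \<open>\<open>\<alpha>\<close> switches \<open>v\<close> with \<open>z\<close>, and \<open>\<beta>\<close> renames \<open>z\<close> to its partner: \<open>w\<close>, \<open>\<alpha> w\<close> and \<open>\<alpha> (\<beta> w)\<close> carry the
    three matchings of the four points, and \<open>F\<close> reads off the value of \<open>f\<close>.\<close>
  define W where "W = (SIGMA p:?M. S - {v, p v})"
  define \<alpha> where "\<alpha> = (\<lambda>(p, z). (relabel v z p, z :: 'a))"
  define \<beta> where "\<beta> = (\<lambda>(p :: 'a \<Rightarrow> 'a, z). (p, p z))"
  define F where "F = (\<lambda>(p, z :: 'a). f p)"
  have \<alpha>: "\<alpha> w \<in> W \<and> \<alpha> (\<alpha> w) = w" if w: "w \<in> W" for w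
  proof -
    obtain p z where pz: "w = (p, z)" "p \<in> ?M" "z \<in> S" "z \<noteq> v" "z \<noteq> p v"
      using w by (auto simp: W_def)
    have "p z \<noteq> v" "p z \<noteq> z" using pz matchings_onD[OF pz(2)] v by metis+
    then have "relabel v z p v = p z" by (simp add: relabel_def)
    then show ?thesis
      using pz relabel_in[OF st v pz(3,2)] \<open>p z \<noteq> z\<close> by (auto simp: \<alpha>_def W_def)
  qed
  have \<beta>: "\<beta> w \<in> W \<and> \<beta> (\<beta> w) = w \<and> F (\<beta> w) = F w" if w: "w \<in> W" for w
  proof -
    obtain p z where pz: "w = (p, z)" "p \<in> ?M" "z \<in> S" "z \<noteq> v" "z \<noteq> p v"
      using w by (auto simp: W_def)
    have "p z \<noteq> v" "p z \<noteq> p v" using pz matchings_onD[OF pz(2)] v by metis+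
    then show ?thesis
      using pz matchings_onD[OF pz(2,3)] by (auto simp: \<beta>_def W_def F_def)
  qed
  have braid: "F (\<alpha> (\<beta> (\<alpha> w))) = F (\<alpha> (\<beta> w))" if w: "w \<in> W" for w
  proof -
    obtain p z where pz: "w = (p, z)" "p \<in> ?M" "z \<in> S" "z \<noteq> v" "p v \<noteq> z"
      using w by (auto simp: W_def)
    then show ?thesis
      using relabel_braid[OF st pz(2) v pz(3-5)] by (simp add: \<alpha>_def \<beta>_def F_def)
  qed
  have re\<alpha>: "(\<Sum>w\<in>W. g (\<alpha> w)) = (\<Sum>w\<in>W. g w)" for g :: "_ \<Rightarrow> real"
    by (rule sum.reindex_bij_witness[of _ \<alpha> \<alpha>]) (use \<alpha> in auto)
  have re\<beta>: "(\<Sum>w\<in>W. g (\<beta> w)) = (\<Sum>w\<in>W. g w)" for g :: "_ \<Rightarrow> real"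
    by (rule sum.reindex_bij_witness[of _ \<beta> \<beta>]) (use \<beta> in auto)
  define X where "X = (\<Sum>w\<in>W. F w * F (\<alpha> w))"
  have sq: "(\<Sum>w\<in>W. (F (\<alpha> w))\<^sup>2) = (\<Sum>w\<in>W. (F w)\<^sup>2)"
    "(\<Sum>w\<in>W. (F (\<alpha> (\<beta> w)))\<^sup>2) = (\<Sum>w\<in>W. (F w)\<^sup>2)"
    using re\<alpha>[of "\<lambda>w. (F w)\<^sup>2"] re\<beta>[of "\<lambda>w. (F (\<alpha> w))\<^sup>2"] by auto
  have c1: "(\<Sum>w\<in>W. F w * F (\<alpha> (\<beta> w))) = X"
  proof -
    have "(\<Sum>w\<in>W. F w * F (\<alpha> (\<beta> w))) = (\<Sum>w\<in>W. F (\<beta> w) * F (\<alpha> (\<beta> w)))"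
      using \<beta> by (intro sum.cong) auto
    then show ?thesis using re\<beta>[of "\<lambda>w. F w * F (\<alpha> w)"] by (simp add: X_def)
  qed
  have c2: "(\<Sum>w\<in>W. F (\<alpha> w) * F (\<alpha> (\<beta> w))) = X"
  proof -
    have "(\<Sum>w\<in>W. F (\<alpha> w) * F (\<alpha> (\<beta> w))) = (\<Sum>w\<in>W. F (\<alpha> (\<alpha> w)) * F (\<alpha> (\<beta> (\<alpha> w))))"
      using re\<alpha>[of "\<lambda>w. F (\<alpha> w) * F (\<alpha> (\<beta> w))"] by simp
    also have "\<dots> = (\<Sum>w\<in>W. F w * F (\<alpha> (\<beta> w)))"
      using \<alpha> braid by (intro sum.cong) auto
    finally show ?thesis using c1 by simp
  qed
  have "0 \<le> (\<Sum>w\<in>W. (F w + F (\<alpha> w) + F (\<alpha> (\<beta> w)))\<^sup>2)" by (simp add: sum_nonneg)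
  also have "\<dots> = (\<Sum>w\<in>W. (F w)\<^sup>2) + (\<Sum>w\<in>W. (F (\<alpha> w))\<^sup>2) + (\<Sum>w\<in>W. (F (\<alpha> (\<beta> w)))\<^sup>2) +
      2 * X + 2 * (\<Sum>w\<in>W. F w * F (\<alpha> (\<beta> w))) + 2 * (\<Sum>w\<in>W. F (\<alpha> w) * F (\<alpha> (\<beta> w)))"
    unfolding X_def sum_distrib_left sum.distrib[symmetric]
    by (intro sum.cong refl) (simp add: power2_eq_square algebra_simps)
  finally have nonneg: "(\<Sum>w\<in>W. (F w)\<^sup>2) + 2 * X \<ge> 0" using sq c1 c2 by simp
  have card_v: "card (S - {v, p v}) = card S - 2" "card S \<ge> 2" if "p \<in> ?M" for p
  proof -
    have "{v, p v} \<subseteq> S" "card {v, p v} = 2" using matchings_onD[OF that v] v by auto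
    then show "card (S - {v, p v}) = card S - 2" "card S \<ge> 2"
      using fin card_mono[of S "{v, p v}"] by (auto simp: card_Diff_subset)
  qed
  have "(\<Sum>w\<in>W. (F w)\<^sup>2) = (\<Sum>p\<in>?M. \<Sum>z\<in>S - {v, p v}. (f p)\<^sup>2)"
    unfolding W_def F_def using fin finM by (subst sum.Sigma) (auto intro!: sum.cong)
  also have "\<dots> = (\<Sum>p\<in>?M. (real (card S) - 2) * (f p)\<^sup>2)"
    using card_v by (intro sum.cong refl) simp
  finally have "(\<Sum>w\<in>W. (F w)\<^sup>2) = (real (card S) - 2) * ?N"
    by (simp add: sum_distrib_left)
  with nonneg have X: "X \<ge> - ((real (card S) - 2) * ?N) / 2" by simp
  \<comment> \<open>The two choices \<open>z = v\<close> and \<open>z = p v\<close> leave \<open>p\<close> unchanged.\<close>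
  have "real (card S) * (\<Sum>p\<in>?M. f p * star_average S v f p) =
      (\<Sum>p\<in>?M. f p * (\<Sum>z\<in>S. f (relabel v z p)))"
    unfolding sum_distrib_left[of "real (card S)"] using n
    by (intro sum.cong refl) (simp add: star_average_def)
  also have "\<dots> = (\<Sum>p\<in>?M. 2 * (f p)\<^sup>2 + (\<Sum>z\<in>S - {v, p v}. f p * f (relabel v z p)))"
  proof (rule sum.cong[OF refl])
    fix p assume p: "p \<in> ?M"
    have "(\<Sum>z\<in>S. f (relabel v z p)) =
        (\<Sum>z\<in>{v, p v}. f (relabel v z p)) + (\<Sum>z\<in>S - {v, p v}. f (relabel v z p))"
      using fin v matchings_onD[OF p v] by (subst sum.subset_diff[of "{v, p v}"]) auto
    also have "(\<Sum>z\<in>{v, p v}. f (relabel v z p)) = 2 * f p"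
      using matchings_onD(2)[OF p v] relabel_partner[OF st p v] by simp
    finally show "f p * (\<Sum>z\<in>S. f (relabel v z p)) =
        2 * (f p)\<^sup>2 + (\<Sum>z\<in>S - {v, p v}. f p * f (relabel v z p))"
      by (simp add: power2_eq_square algebra_simps sum_distrib_left)
  qed
  also have "\<dots> = 2 * ?N + X"
  proof -
    have "X = (\<Sum>p\<in>?M. \<Sum>z\<in>S - {v, p v}. f p * f (relabel v z p))"
      unfolding X_def W_def F_def \<alpha>_def using fin finM
      by (subst sum.Sigma) (auto intro!: sum.cong)
    then show ?thesis by (simp add: sum.distrib sum_distrib_left)
  qed
  finally have "real (card S) * (\<Sum>p\<in>?M. f p * star_average S v f p) \<ge>
      2 * ?N - (real (card S) - 2) * ?N / 2"
    using X by linarith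
  moreover have "2 * ?N - (real (card S) - 2) * ?N / 2 \<ge> real (card S) * (- ?N / 2)"
    by (simp add: field_simps sum_nonneg)
  ultimately have "real (card S) * (- ?N / 2) \<le>
      real (card S) * (\<Sum>p\<in>?M. f p * star_average S v f p)" by linarith
  then show ?thesis using n by (simp only: mult_le_cancel_left_pos)
qed

text \<open>With \<open>A\<close> the star average, \<open>B = 1 - A\<close> and \<open>C = A + 1 / 2\<close> are positive semidefinite, commute
  and add up to \<open>3 / 2\<close>, so \<open>B C = (2 / 3) * (B C B + C B C)\<close> is positive semidefinite as well; this
  is the claim \<open>A\<^sup>2 \<le> (1 + A) / 2\<close>.\<close>

lemma star_average_square_le:
  assumes fin: "finite S" and st: "r ` (- S) \<subseteq> - S" and v: "v \<in> S"
  shows "(\<Sum>p\<in>matchings_on S r. (star_average S v f p)\<^sup>2) \<le>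
    ((\<Sum>p\<in>matchings_on S r. (f p)\<^sup>2) + (\<Sum>p\<in>matchings_on S r. f p * star_average S v f p)) / 2"
proof -
  define I where "I g h = (\<Sum>p\<in>matchings_on S r. g p * h p)" for g h :: "('a \<Rightarrow> 'a) \<Rightarrow> real"
  define A where "A = star_average S v"
  have n: "real (card S) > 0" using fin v by (auto simp: card_gt_0_iff)
  have I_sym: "I g h = I h g" for g h by (simp add: I_def mult.commute)
  have I_lin: "I (\<lambda>p. a * g p + b * h p) k = a * I g k + b * I h k" for g h k a b
    by (simp add: I_def sum.distrib sum_distrib_left algebra_simps)
  have I_lin': "I k (\<lambda>p. a * g p + b * h p) = a * I k g + b * I k h" for g h k a b
    using I_lin I_sym by metis
  have A_lin: "A (\<lambda>p. a * g p + b * h p) = (\<lambda>p. a * A g p + b * A h p)" for g h a b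
    by (simp add: A_def star_average_def fun_eq_iff sum.distrib sum_distrib_left[symmetric]
        add_divide_distrib)
  have adj: "I g (A h) = I (A g) h" for g h
    using star_average_self_adjoint[OF st v] by (simp add: I_def A_def)
  have B: "I g (A g) \<le> I g g" for g
  proof -
    have "0 \<le> (\<Sum>p\<in>matchings_on S r. \<Sum>z\<in>S. jump g p v z)" by (simp add: sum_nonneg)
    then show ?thesis
      using star_average_energy[OF fin st v, of g] n
      by (simp add: I_def A_def power2_eq_square zero_le_mult_iff)
  qed
  have C: "I g (A g) \<ge> - I g g / 2" for g
    using star_average_ge_neg_half[OF fin st v, of g] by (simp add: I_def A_def power2_eq_square)
  have 1: "I (A f) (A (A f)) + I (A f) (A f) + I f (A f) / 4 \<le>
      I (A f) (A f) + I f (A f) + I f f / 4"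
    using B[of "\<lambda>p. 1 * A f p + (1 / 2) * f p"] adj[of f "A f"] I_sym[of "A f" f]
    unfolding A_lin I_lin I_lin' by (simp add: field_simps)
  have 2: "I f (A f) - 2 * I (A f) (A f) + I (A f) (A (A f)) \<ge>
      - (I f f - 2 * I f (A f) + I (A f) (A f)) / 2"
    using C[of "\<lambda>p. 1 * f p + (- 1) * A f p"] adj[of f "A f"] I_sym[of "A f" f]
    unfolding A_lin I_lin I_lin' by (simp add: field_simps)
  have "b \<le> (N + a) / 2"
    if "c + b + a / 4 \<le> b + a + N / 4" "a - 2 * b + c \<ge> - (N - 2 * a + b) / 2" for a b c N :: real
    using that by (simp add: field_simps)
  from this[OF 1 2] have "I (A f) (A f) \<le> (I f f + I f (A f)) / 2" .
  then show ?thesis by (simp add: I_def A_def power2_eq_square)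
qed

text \<open>After \<open>A\<^sup>2\<close> is replaced by \<open>(1 + A) / 2\<close>, the sum over \<open>v\<close> is linear in the transition operator
  of the random transposition walk, and the spectral gap applies. The first summand accounts for
  the draw that joins the two new points, where nothing is averaged: the \<open>n + 1\<close> equally likely
  cases together contribute at most \<open>n\<close> times the squared norm.\<close>

theorem star_average_contraction:
  assumes fin: "finite S" and ne: "S \<noteq> {}" and card: "card S = 2 * k" and st: "r ` (- S) \<subseteq> - S"
    and mean: "(\<Sum>p\<in>matchings_on S r. f p) = 0"
  shows "(\<Sum>p\<in>matchings_on S r. (f p)\<^sup>2) +
      (\<Sum>v\<in>S. \<Sum>p\<in>matchings_on S r. (star_average S v f p)\<^sup>2) \<le>
    real (card S) * (\<Sum>p\<in>matchings_on S r. (f p)\<^sup>2)"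
proof -
  let ?M = "matchings_on S r" and ?n = "real (card S)"
  let ?N = "\<Sum>p\<in>?M. (f p)\<^sup>2"
  let ?E = "\<lambda>v. \<Sum>p\<in>?M. f p * star_average S v f p"
  have n: "?n \<ge> 1" using fin ne by (simp add: Suc_leI card_gt_0_iff)
  have "(\<Sum>v\<in>S. 2 * ?n * (?N - ?E v)) = dirichlet S r f"
    unfolding dirichlet_def using star_average_energy[OF fin st]
    by (subst sum.swap) (intro sum.cong refl, simp)
  then have "2 * ?n * (\<Sum>v\<in>S. ?N - ?E v) \<ge> 4 * ?n * ?N"
    using matchings_spectral_gap[OF fin card st mean] by (simp add: sum_distrib_left)
  then have "2 * ?n * (2 * ?N) \<le> 2 * ?n * (\<Sum>v\<in>S. ?N - ?E v)" by simp
  then have "(\<Sum>v\<in>S. ?N - ?E v) \<ge> 2 * ?N"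
    using n by (subst (asm) mult_le_cancel_left_pos) auto
  then have E: "(\<Sum>v\<in>S. ?E v) \<le> ?n * ?N - 2 * ?N" by (simp add: sum_subtractf)
  have "(\<Sum>v\<in>S. \<Sum>p\<in>?M. (star_average S v f p)\<^sup>2) \<le> (\<Sum>v\<in>S. (?N + ?E v) / 2)"
    by (intro sum_mono star_average_square_le[OF fin st])
  also have "\<dots> = (?n * ?N + (\<Sum>v\<in>S. ?E v)) / 2"
    by (simp add: sum.distrib sum_divide_distrib[symmetric])
  also have "\<dots> \<le> ?n * ?N - ?N" using E by simp
  finally show ?thesis by simp
qed

section \<open>The pairing step as insertion after a random relabelling\<close>

definition pair_sets :: "'a set \<Rightarrow> ('a \<Rightarrow> 'a) \<Rightarrow> 'a set set" where
  "pair_sets S p = (\<lambda>x. {x, p x}) ` S"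

lemma pair_sets_inject:
  assumes p: "p \<in> matchings_on S r" and q: "q \<in> matchings_on S r"
    and eq: "pair_sets S p = pair_sets S q"
  shows "p = q"
proof
  fix x
  show "p x = q x"
  proof (cases "x \<in> S")
    case True
    then have "{x, p x} \<in> pair_sets S q" unfolding eq[symmetric] by (simp add: pair_sets_def)
    then obtain y where y: "y \<in> S" "{x, p x} = {y, q y}" by (auto simp: pair_sets_def)
    then show ?thesis using matchings_onD[OF q y(1)] by (auto simp: doubleton_eq_iff)
  qed (use p q in \<open>simp add: matchings_on_def\<close>)
qed

lemma pair_sets_cong: "(\<And>x. x \<in> S \<Longrightarrow> p x = q x) \<Longrightarrow> pair_sets S p = pair_sets S q"
  unfolding pair_sets_def by (rule image_cong) auto

lemma pair_sets_Un: "pair_sets (S \<union> T) p = pair_sets S p \<union> pair_sets T p"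
  by (simp add: pair_sets_def image_Un)

lemma pair_sets_avoiding:
  assumes p: "p \<in> matchings_on S r" and V: "V \<subseteq> S"
  shows "{e \<in> pair_sets S p. e \<inter> V = {}} = pair_sets (S - (V \<union> p ` V)) p"
proof -
  have "p x \<in> V \<longleftrightarrow> x \<in> p ` V" if "x \<in> S" for x
    using matchings_onD(3)[OF p] that V by (metis image_iff subsetD)
  then show ?thesis by (auto simp: pair_sets_def)
qed

lemma pair_remaining_pair_sets:
  assumes q: "q \<in> matchings_on S r" and R: "R \<subseteq> S" "q ` R \<subseteq> R"
    and w: "w \<in> S" "S - R \<subseteq> {w, q w}"
  shows "pair_remaining S (pair_sets R q) = pair_sets S q"
proof -
  have U: "\<Union> (pair_sets R q) = R" using R by (auto simp: pair_sets_def)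
  show ?thesis
  proof (cases "S - R = {}")
    case True
    then have "R = S" using R by auto
    then show ?thesis using U by (simp add: pair_remaining_def)
  next
    case False
    note qw = matchings_onD[OF q w(1)]
    have "q x \<in> R \<longleftrightarrow> x \<in> R" if "x \<in> S" for x
      using R(2) matchings_onD(3)[OF q that] by (metis image_subset_iff)
    then have SR: "S - R = {w, q w}" using False w qw by auto
    then have "S = R \<union> {w, q w}" using R by auto
    then have "pair_sets S q = pair_sets R q \<union> pair_sets {w, q w} q"
      by (metis pair_sets_Un)
    also have "pair_sets {w, q w} q = {{w, q w}}" using qw by (auto simp: pair_sets_def)
    finally show ?thesis using SR U qw(2) by (simp add: pair_remaining_def card_2_iff)
  qed
qed

abbreviation matchings :: "nat \<Rightarrow> (nat \<Rightarrow> nat) set" where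
  "matchings k \<equiv> matchings_on {1..2 * k} id"

lemma id_stable: "id ` (- S) \<subseteq> - S"
  by simp

text \<open>Breaking up the pair of \<open>v\<close>: the new points \<open>2 * k + 1\<close> and \<open>2 * k + 2\<close> are paired with the two
  ends, \<open>2 * k + 2\<close> with \<open>v\<close> itself. The argument \<open>v = 2 * k + 1\<close> stands for joining the new points
  to each other, so that in all cases \<open>v\<close> is the partner of \<open>2 * k + 2\<close>.\<close>

definition insert_pair :: "nat \<Rightarrow> (nat \<Rightarrow> nat) \<Rightarrow> nat \<Rightarrow> nat \<Rightarrow> nat" where
  "insert_pair k p v =
    (if v = 2 * k + 1 then p(2 * k + 1 := 2 * k + 2, 2 * k + 2 := 2 * k + 1)
     else p(v := 2 * k + 2, 2 * k + 2 := v, p v := 2 * k + 1, 2 * k + 1 := p v))"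

definition remove_pair :: "nat \<Rightarrow> (nat \<Rightarrow> nat) \<Rightarrow> nat \<Rightarrow> nat" where
  "remove_pair k q =
    (let v = q (2 * k + 2); u = q (2 * k + 1) in
     if v = 2 * k + 1 then q(2 * k + 1 := 2 * k + 1, 2 * k + 2 := 2 * k + 2)
     else q(v := u, u := v, 2 * k + 1 := 2 * k + 1, 2 * k + 2 := 2 * k + 2))"

lemma insert_pair_in:
  assumes p: "p \<in> matchings k" and v: "v \<in> {1..2 * k + 1}"
  shows "insert_pair k p v \<in> matchings (k + 1)"
proof -
  have old: "p x \<in> {1..2 * k} \<and> p x \<noteq> x \<and> p (p x) = x" if "x \<in> {1..2 * k}" for x
    using matchings_onD[OF p that] by blast
  have out: "p x = x" if "x \<notin> {1..2 * k}" for x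
    using p that by (simp add: matchings_on_def)
  show ?thesis
  proof (cases "v = 2 * k + 1")
    case True
    have "insert_pair k p v x \<in> {1..2 * (k + 1)} \<and> insert_pair k p v x \<noteq> x \<and>
        insert_pair k p v (insert_pair k p v x) = x" if "x \<in> {1..2 * (k + 1)}" for x
    proof (cases "x \<in> {1..2 * k}")
      case True
      with \<open>v = 2 * k + 1\<close> show ?thesis using old[OF True] by (auto simp: insert_pair_def)
    next
      case False
      then have "x = 2 * k + 1 \<or> x = 2 * k + 2" using that by auto
      with \<open>v = 2 * k + 1\<close> show ?thesis by (auto simp: insert_pair_def)
    qed
    then show ?thesis using out True by (auto simp: matchings_on_def insert_pair_def)
  next
    case False
    then have v': "v \<in> {1..2 * k}" using v by auto
    note pv = old[OF v']
    have "insert_pair k p v x \<in> {1..2 * (k + 1)} \<and> insert_pair k p v x \<noteq> x \<and>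
        insert_pair k p v (insert_pair k p v x) = x" if "x \<in> {1..2 * (k + 1)}" for x
    proof -
      have "x \<in> {1..2 * k} \<or> x = 2 * k + 1 \<or> x = 2 * k + 2" using that by auto
      then consider "x = 2 * k + 1 \<or> x = 2 * k + 2 \<or> x = v \<or> x = p v"
        | "x \<in> {1..2 * k}" "x \<noteq> v" "x \<noteq> p v"
        by blast
      then show ?thesis
      proof cases
        case 1
        then show ?thesis using pv v' False by (auto simp: insert_pair_def)
      next
        case 2
        then have "p x \<noteq> v" "p x \<noteq> p v" using old[OF 2(1)] pv by metis+
        then show ?thesis using old[OF 2(1)] 2 False pv by (auto simp: insert_pair_def)
      qed
    qed
    moreover have "insert_pair k p v x = x" if "x \<notin> {1..2 * (k + 1)}" for x
    proof -
      have "x \<noteq> v" "x \<noteq> p v" using that v' pv by auto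
      then show ?thesis using that out[of x] False by (auto simp: insert_pair_def)
    qed
    ultimately show ?thesis by (simp add: matchings_on_def)
  qed
qed

lemma insert_pair_new:
  assumes p: "p \<in> matchings k" and v: "v \<in> {1..2 * k + 1}"
  shows "insert_pair k p v (2 * k + 2) = v"
proof -
  have "p v \<noteq> 2 * k + 2" if "v \<noteq> 2 * k + 1" using matchings_onD(1)[OF p, of v] v that by auto
  then show ?thesis unfolding insert_pair_def by (cases "v = 2 * k + 1") auto
qed

lemma remove_insert_pair:
  assumes p: "p \<in> matchings k" and v: "v \<in> {1..2 * k + 1}"
  shows "remove_pair k (insert_pair k p v) = p"
proof -
  have out: "p (2 * k + 1) = 2 * k + 1" "p (2 * k + 2) = 2 * k + 2"
    using p by (simp_all add: matchings_on_def)
  show ?thesis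
  proof (cases "v = 2 * k + 1")
    case True
    then show ?thesis using out by (auto simp: remove_pair_def insert_pair_def)
  next
    case False
    then have v': "v \<in> {1..2 * k}" using v by auto
    note pv = matchings_onD[OF p v']
    have "insert_pair k p v (2 * k + 1) = p v" using False by (simp add: insert_pair_def)
    then show ?thesis
      unfolding remove_pair_def insert_pair_new[OF p v] Let_def
      using False pv v' out by (auto simp: insert_pair_def fun_eq_iff)
  qed
qed

lemma insert_remove_pair:
  assumes q: "q \<in> matchings (k + 1)"
  shows "remove_pair k q \<in> matchings k" "q (2 * k + 2) \<in> {1..2 * k + 1}"
    "insert_pair k (remove_pair k q) (q (2 * k + 2)) = q"
proof -
  let ?a = "2 * k + 1" and ?b = "2 * k + 2"
  have S: "?a \<in> {1..2 * (k + 1)}" "?b \<in> {1..2 * (k + 1)}" by auto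
  note qa = matchings_onD[OF q S(1)] and qb = matchings_onD[OF q S(2)]
  have old: "q x \<in> {1..2 * (k + 1)} \<and> q x \<noteq> x \<and> q (q x) = x" if "x \<in> {1..2 * (k + 1)}" for x
    using matchings_onD[OF q that] by blast
  have out: "q x = x" if "x \<notin> {1..2 * (k + 1)}" for x
    using q that by (simp add: matchings_on_def)
  have old': "q x \<in> {1..2 * k} \<and> q x \<noteq> q ?a \<and> q x \<noteq> q ?b"
    if "x \<in> {1..2 * k}" "x \<noteq> q ?a" "x \<noteq> q ?b" for x
  proof -
    have "x \<in> {1..2 * (k + 1)}" "x \<noteq> ?a" "x \<noteq> ?b" using that by auto
    then have "q x \<noteq> ?a" "q x \<noteq> ?b" "q x \<noteq> q ?a" "q x \<noteq> q ?b" "q x \<in> {1..2 * (k + 1)}"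
      using old[of x] qa qb that by metis+
    then show ?thesis by auto
  qed
  show v: "q ?b \<in> {1..2 * k + 1}" using qb(1,2) by auto
  show "remove_pair k q \<in> matchings k"
  proof (cases "q ?b = ?a")
    case True
    then have "q ?a = ?b" using qb by simp
    then have "q x \<in> {1..2 * k} \<and> q x \<noteq> x \<and> q (q x) = x" if "x \<in> {1..2 * k}" for x
      using old'[OF that] old[of x] that True by auto
    moreover have "remove_pair k q x = (if x \<in> {1..2 * k} then q x else x)" for x
      using out[of x] True by (auto simp: remove_pair_def)
    ultimately show ?thesis by (simp add: matchings_on_def)
  next
    case False
    then have "q ?a \<noteq> ?b" using qa by metis
    then have v: "q ?b \<in> {1..2 * k}" "q ?a \<in> {1..2 * k}" "q ?a \<noteq> q ?b"
      using False qa qb by auto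
    have "remove_pair k q x \<in> {1..2 * k} \<and> remove_pair k q x \<noteq> x \<and>
        remove_pair k q (remove_pair k q x) = x" if x: "x \<in> {1..2 * k}" for x
    proof (cases "x = q ?a \<or> x = q ?b")
      case True
      then show ?thesis using v False by (auto simp: remove_pair_def Let_def)
    next
      case no: False
      then show ?thesis
        using old'[OF x] old[of x] x v False by (auto simp: remove_pair_def Let_def)
    qed
    moreover have "remove_pair k q x = x" if "x \<notin> {1..2 * k}" for x
    proof -
      have "x \<noteq> q ?a" "x \<noteq> q ?b" using that v by auto
      then show ?thesis using out[of x] that False by (auto simp: remove_pair_def Let_def)
    qed
    ultimately show ?thesis by (simp add: matchings_on_def)
  qed
  show "insert_pair k (remove_pair k q) (q ?b) = q"
  proof (cases "q ?b = ?a")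
    case True
    then show ?thesis using qb by (auto simp: insert_pair_def remove_pair_def)
  next
    case False
    then have ab: "q ?a \<noteq> ?b" using qa by metis
    then have "q ?b \<in> {1..2 * k}" "q ?a \<in> {1..2 * k}" "q ?a \<noteq> q ?b"
      using False qa qb by auto
    then show ?thesis
      using False qa qb ab by (auto simp: insert_pair_def remove_pair_def Let_def fun_eq_iff)
  qed
qed

lemma insert_pair_bij:
  "bij_betw (\<lambda>(v, p). insert_pair k p v) ({1..2 * k + 1} \<times> matchings k) (matchings (k + 1))"
proof (rule bij_betw_byWitness[where f' = "\<lambda>q. (q (2 * k + 2), remove_pair k q)"])
  show "\<forall>a\<in>{1..2 * k + 1} \<times> matchings k. (\<lambda>q. (q (2 * k + 2), remove_pair k q))
      ((\<lambda>(v, p). insert_pair k p v) a) = a"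
    using insert_pair_new remove_insert_pair by auto
  show "\<forall>q\<in>matchings (k + 1). (\<lambda>(v, p). insert_pair k p v) (q (2 * k + 2), remove_pair k q) = q"
    using insert_remove_pair(3) by auto
  show "(\<lambda>(v, p). insert_pair k p v) ` ({1..2 * k + 1} \<times> matchings k) \<subseteq> matchings (k + 1)"
    using insert_pair_in by auto
  show "(\<lambda>q. (q (2 * k + 2), remove_pair k q)) ` matchings (k + 1) \<subseteq> {1..2 * k + 1} \<times> matchings k"
    using insert_remove_pair(1,2) by auto
qed

definition next_matching :: "nat \<Rightarrow> (nat \<Rightarrow> nat) \<Rightarrow> nat \<Rightarrow> nat \<Rightarrow> nat \<Rightarrow> nat" where
  "next_matching k p u1 u2 =
    insert_pair k (if u2 = 2 * k + 1 then p else relabel u2 (p u1) p) u2"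

lemma next_matching_in:
  assumes p: "p \<in> matchings k" and u: "u1 \<in> {1..2 * k}" "u2 \<in> {1..2 * k + 1}"
  shows "next_matching k p u1 u2 \<in> matchings (k + 1)"
proof -
  have "relabel u2 (p u1) p \<in> matchings k" if "u2 \<noteq> 2 * k + 1"
    by (rule relabel_in[OF id_stable]) (use that u p matchings_onD[OF p u(1)] in auto)
  then show ?thesis unfolding next_matching_def using p u by (intro insert_pair_in) auto
qed

text \<open>Relabelling \<open>u2\<close> and the partner of \<open>u1\<close> makes \<open>u1\<close> and \<open>u2\<close> partners and pairs their former
  partners with each other; breaking up \<open>u1\<close> and \<open>u2\<close> then gives the result of the pairing step.
  The cases \<open>u1 = u2\<close> and \<open>u1 = p u2\<close> both leave \<open>p\<close> unchanged before the insertion.\<close>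

lemma pairing_step_pair_sets:
  assumes p: "p \<in> matchings k" and u: "u1 \<in> {1..2 * k}" "u2 \<in> {1..2 * k + 1}"
  shows "pairing_step k (pair_sets {1..2 * k} p) u1 u2 =
    pair_sets {1..2 * k + 2} (next_matching k p u1 u2)"
proof -
  let ?S = "{1..2 * k}" and ?T = "{1..2 * k + 2}" and ?a = "2 * k + 1" and ?b = "2 * k + 2"
  define q where "q = next_matching k p u1 u2"
  have q: "q \<in> matchings_on ?T id" using next_matching_in[OF assms] by (simp add: q_def)
  have T: "?T = ?S \<union> {?a, ?b}" by auto
  show ?thesis
  proof (cases "u2 = ?a")
    case True
    have "pair_sets ?S q = pair_sets ?S p"
      by (rule pair_sets_cong) (simp add: q_def next_matching_def insert_pair_def True)
    moreover have "pair_sets {?a, ?b} q = {{?a, ?b}}"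
      by (auto simp: q_def next_matching_def insert_pair_def pair_sets_def True)
    ultimately have "pair_sets ?T q = pair_sets ?S p \<union> {{?a, ?b}}"
      unfolding T pair_sets_Un by simp
    then show ?thesis using True by (simp add: pairing_step_def q_def)
  next
    case False
    then have u2: "u2 \<in> ?S" using u by auto
    note p1 = matchings_onD[OF p u(1)] and p2 = matchings_onD[OF p u2]
    have old: "p x \<in> ?S \<and> p x \<noteq> x \<and> p (p x) = x" if "x \<in> ?S" for x
      using matchings_onD[OF p that] by blast
    show ?thesis
    proof (cases "u1 = u2")
      case True
      have q_eq: "q = p(u2 := ?b, ?b := u2, p u2 := ?a, ?a := p u2)"
        using False True relabel_partner[OF id_stable p u2]
        by (simp add: q_def next_matching_def insert_pair_def)
      let ?A = "?S - ({u2} \<union> p ` {u2})"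
      have "{e \<in> pair_sets ?S p. u2 \<notin> e} = pair_sets ?A p"
        using pair_sets_avoiding[OF p, of "{u2}"] u2 by simp
      also have "\<dots> = pair_sets ?A q" by (rule pair_sets_cong) (auto simp: q_eq)
      finally have "{e \<in> pair_sets ?S p. u2 \<notin> e} \<union> {{?b, u2}} = pair_sets (?A \<union> {?b, u2}) q"
        using u2 p2 by (simp add: pair_sets_Un) (auto simp: pair_sets_def q_eq)
      moreover have "pair_remaining ?T (pair_sets (?A \<union> {?b, u2}) q) = pair_sets ?T q"
      proof (rule pair_remaining_pair_sets[OF q])
        show "?A \<union> {?b, u2} \<subseteq> ?T" using u2 by auto
        have "q x \<in> ?A" if "x \<in> ?A" for x
        proof -
          have "p x \<noteq> u2" "p x \<noteq> p u2" using that old[of x] p2 by auto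
          then show ?thesis using that old[of x] by (auto simp: q_eq)
        qed
        moreover have "q ?b = u2" "q u2 = ?b" using u2 p2 by (auto simp: q_eq)
        ultimately show "q ` (?A \<union> {?b, u2}) \<subseteq> ?A \<union> {?b, u2}" by auto
        show "p u2 \<in> ?T" using p2 by auto
        have "q (p u2) = ?a" using p2 by (auto simp: q_eq)
        then show "?T - (?A \<union> {?b, u2}) \<subseteq> {p u2, q (p u2)}" by auto
      qed
      ultimately show ?thesis using True False by (simp add: pairing_step_def q_def)
    next
      case ne: False
      define p' where "p' = relabel u2 (p u1) p"
      have p'_u2: "p' u2 = u1"
      proof (cases "u2 = p u1")
        case True
        then show ?thesis using p1 by (simp add: p'_def)
      next
        case no: False
        have "u2 \<noteq> p (p u1)" "p u1 \<noteq> p (p u1)" using p1 ne by auto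
        then show ?thesis using p1 by (simp add: p'_def relabel_def)
      qed
      have q_eq: "q = p'(u2 := ?b, ?b := u2, u1 := ?a, ?a := u1)"
        using False p'_u2 by (simp add: q_def next_matching_def insert_pair_def p'_def[symmetric])
      let ?A = "?S - ({u1, u2} \<union> p ` {u1, u2})" and ?B = "{?a, u1, ?b, u2}"
      have q_new: "q ?a = u1" "q u1 = ?a" "q ?b = u2" "q u2 = ?b"
        using u u2 ne by (auto simp: q_eq)
      have q_A: "q x = p x \<and> q x \<in> ?A" if "x \<in> ?A" for x
      proof -
        have n: "p x \<noteq> u1" "p x \<noteq> u2" "p x \<noteq> p u1" "p x \<noteq> p u2"
          using that old[of x] p1 p2 by auto
        then have "p' x = p x" using that by (simp add: p'_def relabel_def)
        then have "q x = p x" using that by (auto simp: q_eq)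
        then show ?thesis using n that old[of x] by auto
      qed
      have "{e \<in> pair_sets ?S p. u1 \<notin> e \<and> u2 \<notin> e} = pair_sets ?A p"
        using pair_sets_avoiding[OF p, of "{u1, u2}"] u2 u by simp
      also have "\<dots> = pair_sets ?A q" by (rule pair_sets_cong) (use q_A in auto)
      finally have "{e \<in> pair_sets ?S p. u1 \<notin> e \<and> u2 \<notin> e} \<union> {{?a, u1}, {?b, u2}} =
          pair_sets (?A \<union> ?B) q"
        using q_new by (simp only: pair_sets_Un) (auto simp: pair_sets_def)
      moreover have "pair_remaining ?T (pair_sets (?A \<union> ?B) q) = pair_sets ?T q"
      proof (rule pair_remaining_pair_sets[OF q])
        show "?A \<union> ?B \<subseteq> ?T" using u2 u by auto
        show "q ` (?A \<union> ?B) \<subseteq> ?A \<union> ?B"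
        proof (rule image_subsetI)
          fix x assume "x \<in> ?A \<union> ?B"
          then consider "x \<in> ?A" | "x \<in> ?B" by blast
          then show "q x \<in> ?A \<union> ?B"
          proof cases
            case 1
            then show ?thesis using q_A by blast
          next
            case 2
            then have "q x \<in> ?B" using q_new by auto
            then show ?thesis by blast
          qed
        qed
        show "p u1 \<in> ?T" using p1 by auto
        have "q (p u1) = p u2" if "p u1 \<noteq> u2"
        proof -
          have "p u2 \<noteq> u1" "p u2 \<noteq> p u1" using that ne p1 p2 by metis+
          then have "p' (p u1) = p u2" using p2 that by (simp add: p'_def relabel_def)
          then show ?thesis using p1 that by (auto simp: q_eq)
        qed
        then have "p u2 \<in> {u1, p u1, q (p u1)}" using p1 by (cases "p u1 = u2") auto
        then show "?T - (?A \<union> ?B) \<subseteq> {p u1, q (p u1)}" by auto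
      qed
      ultimately show ?thesis using False ne by (simp add: pairing_step_def q_def)
    qed
  qed
qed

section \<open>Decay of the density fluctuations\<close>

text \<open>The effect of one pairing step with uniform draws on a (signed) mass distribution.\<close>

definition push_forward :: "nat \<Rightarrow> ((nat \<Rightarrow> nat) \<Rightarrow> real) \<Rightarrow> (nat \<Rightarrow> nat) \<Rightarrow> real" where
  "push_forward k \<mu> q = (\<Sum>p\<in>matchings k. \<Sum>u1\<in>{1..2 * k}. \<Sum>u2\<in>{1..2 * k + 1}.
     if next_matching k p u1 u2 = q then \<mu> p / (2 * k * (2 * k + 1)) else 0)"

text \<open>The map \<open>u1 \<mapsto> p u1\<close> is a bijection, so the point exchanged with \<open>v\<close> is uniform. Since
  relabelling is an involution, the preimages of a given matching are its own relabellings, and their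
  masses are collected by the star average at \<open>v\<close>.\<close>

lemma push_forward_insert_pair:
  assumes k: "k \<ge> 1" and p: "p \<in> matchings k" and v: "v \<in> {1..2 * k + 1}"
  shows "push_forward k \<mu> (insert_pair k p v) =
    (if v = 2 * k + 1 then \<mu> p else star_average {1..2 * k} v \<mu> p) / (2 * k + 1)"
proof -
  let ?S = "{1..2 * k}"
  let ?c = "real (2 * k * (2 * k + 1))"
  have fin: "finite (matchings k)" by (rule finite_matchings_on) simp
  have eq: "next_matching k p0 u1 u2 = insert_pair k p v \<longleftrightarrow>
      u2 = v \<and> (if v = 2 * k + 1 then p0 = p else relabel v (p0 u1) p0 = p)"
    if p0: "p0 \<in> matchings k" and u: "u1 \<in> ?S" "u2 \<in> {1..2 * k + 1}" for p0 u1 u2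
  proof -
    let ?p' = "if u2 = 2 * k + 1 then p0 else relabel u2 (p0 u1) p0"
    have "?p' \<in> matchings k"
      using p0 relabel_in[OF id_stable _ _ p0, of u2 "p0 u1"] matchings_onD[OF p0 u(1)] u by auto
    then have "u2 = v \<and> ?p' = p" if "insert_pair k ?p' u2 = insert_pair k p v"
      using insert_pair_new[of ?p' k u2] remove_insert_pair[of ?p' k u2] u(2)
        insert_pair_new[OF p v] remove_insert_pair[OF p v] that by simp
    then have "insert_pair k ?p' u2 = insert_pair k p v \<longleftrightarrow> u2 = v \<and> ?p' = p" by blast
    then show ?thesis by (auto simp: next_matching_def)
  qed
  have "push_forward k \<mu> (insert_pair k p v) =
      (\<Sum>p0\<in>matchings k. \<Sum>u1\<in>?S. \<Sum>u2\<in>{1..2 * k + 1}. if u2 = v then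
        (if (if v = 2 * k + 1 then p0 = p else relabel v (p0 u1) p0 = p) then \<mu> p0 / ?c else 0)
        else 0)"
    unfolding push_forward_def by (intro sum.cong refl) (simp only: eq, simp)
  also have "\<dots> = (\<Sum>p0\<in>matchings k. \<Sum>u1\<in>?S.
      if (if v = 2 * k + 1 then p0 = p else relabel v (p0 u1) p0 = p) then \<mu> p0 / ?c else 0)"
    by (simp only: sum.delta[OF finite_atLeastAtMost] v if_True)
  also have "\<dots> = (if v = 2 * k + 1 then \<mu> p else star_average ?S v \<mu> p) / (2 * k + 1)"
  proof (cases "v = 2 * k + 1")
    case True
    then have "(\<Sum>p0\<in>matchings k. \<Sum>u1\<in>?S.
        if (if v = 2 * k + 1 then p0 = p else relabel v (p0 u1) p0 = p) then \<mu> p0 / ?c else 0) =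
        (\<Sum>p0\<in>matchings k. if p0 = p then real (2 * k) * (\<mu> p / ?c) else 0)"
      by (intro sum.cong refl) simp
    also have "\<dots> = real (2 * k) * (\<mu> p / ?c)"
      using p fin by (simp only: sum.delta if_True)
    also have "\<dots> = \<mu> p / (2 * k + 1)"
      using k unfolding of_nat_mult by simp
    finally show ?thesis using True by simp
  next
    case False
    then have v': "v \<in> ?S" using v by auto
    have "(\<Sum>p0\<in>matchings k. \<Sum>u1\<in>?S.
        if (if v = 2 * k + 1 then p0 = p else relabel v (p0 u1) p0 = p) then \<mu> p0 / ?c else 0) =
        (\<Sum>p0\<in>matchings k. \<Sum>u1\<in>?S. if relabel v (p0 u1) p0 = p then \<mu> p0 / ?c else 0)"
      using False by simp
    also have "\<dots> = (\<Sum>p0\<in>matchings k. \<Sum>z\<in>?S. if relabel v z p0 = p then \<mu> p0 / ?c else 0)"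
    proof (rule sum.cong[OF refl])
      fix p0 assume p0: "p0 \<in> matchings k"
      show "(\<Sum>u1\<in>?S. if relabel v (p0 u1) p0 = p then \<mu> p0 / ?c else 0) =
          (\<Sum>z\<in>?S. if relabel v z p0 = p then \<mu> p0 / ?c else 0)"
        by (rule sum.reindex_bij_witness[of _ p0 p0]) (use matchings_onD[OF p0] in auto)
    qed
    also have "\<dots> = (\<Sum>z\<in>?S. \<Sum>p0\<in>matchings k. if p0 = relabel v z p then \<mu> (relabel v z p) / ?c else 0)"
      by (subst sum.swap) (intro sum.cong refl, metis relabel_relabel)
    also have "\<dots> = (\<Sum>z\<in>?S. \<mu> (relabel v z p) / ?c)"
    proof (rule sum.cong[OF refl])
      fix z assume "z \<in> ?S"
      then have "relabel v z p \<in> matchings k" using relabel_in[OF id_stable v' _ p] by blast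
      then show "(\<Sum>p0\<in>matchings k. if p0 = relabel v z p then \<mu> (relabel v z p) / ?c else 0) =
          \<mu> (relabel v z p) / ?c"
        using fin by simp
    qed
    also have "\<dots> = star_average ?S v \<mu> p / (2 * k + 1)"
    proof -
      have "card ?S = 2 * k" by simp
      then show ?thesis
        unfolding star_average_def sum_divide_distrib
        by (simp only: divide_divide_eq_left of_nat_mult[symmetric])
    qed
    finally show ?thesis using False by simp
  qed
  finally show ?thesis .
qed

lemma sum_matchings_Suc:
  fixes g :: "(nat \<Rightarrow> nat) \<Rightarrow> real"
  shows "(\<Sum>q\<in>matchings (k + 1). g q) =
    (\<Sum>p\<in>matchings k. g (insert_pair k p (2 * k + 1))) +
    (\<Sum>v\<in>{1..2 * k}. \<Sum>p\<in>matchings k. g (insert_pair k p v))"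
proof -
  have "(\<Sum>q\<in>matchings (k + 1). g q) = (\<Sum>(v, p)\<in>{1..2 * k + 1} \<times> matchings k. g (insert_pair k p v))"
    using sum.reindex_bij_betw[OF insert_pair_bij, of g k] by (simp add: case_prod_beta)
  also have "\<dots> = (\<Sum>v\<in>{1..2 * k + 1}. \<Sum>p\<in>matchings k. g (insert_pair k p v))"
    by (rule sum.cartesian_product[symmetric])
  finally show ?thesis by simp
qed

text \<open>The squared \<open>L\<^sup>2\<close> norm, with respect to the uniform distribution, of the density of \<open>\<mu>\<close>. It
  dominates the square of the total mass of \<open>\<bar>\<mu>\<bar>\<close>.\<close>

definition sq_density_norm :: "nat \<Rightarrow> ((nat \<Rightarrow> nat) \<Rightarrow> real) \<Rightarrow> real" where
  "sq_density_norm k \<mu> = real (card (matchings k)) * (\<Sum>p\<in>matchings k. (\<mu> p)\<^sup>2)"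

lemma sum_abs_le_sq_density_norm: "(\<Sum>p\<in>matchings k. \<bar>\<mu> p\<bar>)\<^sup>2 \<le> sq_density_norm k \<mu>"
  using sum_squared_le_card[of "\<lambda>p. \<bar>\<mu> p\<bar>" "matchings k"] by (simp add: sq_density_norm_def)

lemma sq_density_norm_push_forward:
  assumes k: "k \<ge> 1" and mean: "(\<Sum>p\<in>matchings k. \<mu> p) = 0"
  shows "sq_density_norm (k + 1) (push_forward k \<mu>) \<le>
    2 * real k / (2 * real k + 1) * sq_density_norm k \<mu>"
proof -
  let ?S = "{1..2 * k}" and ?N = "\<Sum>p\<in>matchings k. (\<mu> p)\<^sup>2"
  have card: "real (card (matchings (k + 1))) = (2 * k + 1) * card (matchings k)"
    using sum_matchings_Suc[of "\<lambda>_. 1" k] by (simp add: algebra_simps)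
  have "(\<Sum>q\<in>matchings (k + 1). (push_forward k \<mu> q)\<^sup>2) =
      (\<Sum>p\<in>matchings k. (\<mu> p / (2 * k + 1))\<^sup>2) +
      (\<Sum>v\<in>?S. \<Sum>p\<in>matchings k. (star_average ?S v \<mu> p / (2 * k + 1))\<^sup>2)"
    unfolding sum_matchings_Suc using push_forward_insert_pair[OF k]
    by (intro arg_cong2[where f = "(+)"] sum.cong refl) auto
  also have "\<dots> = (?N + (\<Sum>v\<in>?S. \<Sum>p\<in>matchings k. (star_average ?S v \<mu> p)\<^sup>2)) / (2 * k + 1)\<^sup>2"
    by (simp add: power_divide sum_divide_distrib[symmetric] add_divide_distrib)
  also have "\<dots> \<le> (2 * k * ?N) / (2 * k + 1)\<^sup>2"
  proof (rule divide_right_mono)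
    show "?N + (\<Sum>v\<in>?S. \<Sum>p\<in>matchings k. (star_average ?S v \<mu> p)\<^sup>2) \<le> 2 * k * ?N"
      using star_average_contraction[OF _ _ _ id_stable mean] k by simp
  qed simp
  finally have "sq_density_norm (k + 1) (push_forward k \<mu>) \<le>
      ((2 * k + 1) * card (matchings k)) * ((2 * k * ?N) / (2 * k + 1)\<^sup>2)"
    unfolding sq_density_norm_def card by (intro mult_left_mono) auto
  also have "\<dots> = 2 * k / (2 * k + 1) * sq_density_norm k \<mu>"
  proof -
    have "(a * c) * ((b * N) / a\<^sup>2) = b / a * (c * N)" if "a \<noteq> 0" for a b c N :: real
      using that by (simp add: power2_eq_square)
    from this[of "real (2 * k + 1)"] show ?thesis
      unfolding sq_density_norm_def of_nat_mult[of "2 * k + 1"] of_nat_power by simp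
  qed
  finally show ?thesis by (simp add: add.commute)
qed

text \<open>The defects \<open>1 / (2 * k + 1)\<close> of the contraction factors have divergent sum; concretely,
  \<open>k * (x k)\<^sup>2\<close> does not increase.\<close>

lemma contracting_sequence_tendsto_0:
  fixes x :: "nat \<Rightarrow> real"
  assumes nonneg: "\<And>n. x n \<ge> 0" and m: "m \<ge> 1"
    and step: "\<And>k. k \<ge> m \<Longrightarrow> x (k + 1) \<le> 2 * real k / (2 * real k + 1) * x k"
  shows "x \<longlonglongrightarrow> 0"
proof -
  have bound: "real k * (x k)\<^sup>2 \<le> real m * (x m)\<^sup>2" if "k \<ge> m" for k
    using that
  proof (induction k rule: dec_induct)
    case (step k)
    let ?r = "2 * real k / (2 * real k + 1)"
    have k: "real k > 0" using step m by simp
    have "(x (Suc k))\<^sup>2 \<le> (?r * x k)\<^sup>2"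
      using assms(3)[of k] step nonneg[of "Suc k"] by (intro power_mono) auto
    then have "real (Suc k) * (x (Suc k))\<^sup>2 \<le> real (Suc k) * (?r * x k)\<^sup>2"
      by (rule mult_left_mono) simp
    also have "\<dots> = ((real k + 1) * ?r\<^sup>2) * (x k)\<^sup>2"
      unfolding power_mult_distrib by (simp only: of_nat_Suc mult.assoc add.commute)
    also have "\<dots> \<le> real k * (x k)\<^sup>2"
    proof (rule mult_right_mono)
      have "(real k + 1) * (2 * real k)\<^sup>2 \<le> real k * (2 * real k + 1)\<^sup>2"
        using k by (simp add: power2_eq_square algebra_simps)
      then show "(real k + 1) * ?r\<^sup>2 \<le> real k"
        using k by (simp add: power_divide divide_le_eq)
    qed simp
    finally show ?case using step.IH by simp
  qed simp
  have "(\<lambda>k. (x k)\<^sup>2) \<longlonglongrightarrow> 0"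
  proof (rule tendsto_sandwich)
    show "\<forall>\<^sub>F k in sequentially. 0 \<le> (x k)\<^sup>2" by simp
    show "\<forall>\<^sub>F k in sequentially. (x k)\<^sup>2 \<le> (real m * (x m)\<^sup>2) / real k"
      using eventually_ge_at_top[of m]
    proof eventually_elim
      case (elim k)
      then show ?case using bound[OF elim] m by (simp add: field_simps)
    qed
    show "(\<lambda>k. (real m * (x m)\<^sup>2) / real k) \<longlonglongrightarrow> 0"
      by (rule lim_const_over_n)
  qed simp
  then show ?thesis by simp
qed

section \<open>Tail triviality\<close>

lemma push_forward_diff:
  "push_forward k (\<lambda>p. \<mu> p - c * \<nu> p) q = push_forward k \<mu> q - c * push_forward k \<nu> q"
  unfolding push_forward_def sum_distrib_left sum_subtractf[symmetric]
  by (intro sum.cong refl) (simp add: diff_divide_distrib)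

context dynamic_pairing
begin

definition draw_events :: "nat + nat \<Rightarrow> 'a set set" where
  "draw_events i = {case_sum U1 U2 i -` B \<inter> space M | B. B \<in> sets (count_space UNIV)}"

definition past :: "nat \<Rightarrow> 'a set set" where
  "past n = sigma_sets (space M) (\<Union>i\<in>{1..<n} <+> {1..<n}. draw_events i)"

definition future :: "nat \<Rightarrow> 'a set set" where
  "future n = sigma_sets (space M) (\<Union>i\<in>{n..} <+> {n..}. draw_events i)"

definition state_event :: "nat \<Rightarrow> (nat \<Rightarrow> nat) \<Rightarrow> 'a set" where
  "state_event n p = \<xi> n -` {pair_sets {1..2 * n} p} \<inter> space M"

lemma indep_draw_events: "indep_sets draw_events ({1..} <+> {1..})"
  using indep_draws unfolding indep_vars_def2 draw_events_def by auto

lemma draw_events_sub: "i \<in> {1..} <+> {1..} \<Longrightarrow> draw_events i \<subseteq> events"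
  using indep_draw_events unfolding indep_sets_def by auto

lemma Int_stable_draw_events: "Int_stable (draw_events i)"
proof (unfold Int_stable_def, intro ballI)
  fix A B assume "A \<in> draw_events i" "B \<in> draw_events i"
  then obtain A' B' where "A = case_sum U1 U2 i -` A' \<inter> space M"
    "B = case_sum U1 U2 i -` B' \<inter> space M" by (auto simp: draw_events_def)
  then have "A \<inter> B = case_sum U1 U2 i -` (A' \<inter> B') \<inter> space M" by blast
  then show "A \<inter> B \<in> draw_events i"
    unfolding draw_events_def by (intro CollectI exI[of _ "A' \<inter> B'"]) simp
qed

lemma indep_past_future:
  assumes "n \<ge> 1" "H \<in> past n" "G \<in> future n"
  shows "prob (H \<inter> G) = prob H * prob G"
proof -
  let ?I = "\<lambda>b. if b then {1..<n} <+> {1..<n} else {n..} <+> {n..}"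
  have "indep_sets (\<lambda>b. sigma_sets (space M) (\<Union>i\<in>?I b. draw_events i)) UNIV"
  proof (rule indep_sets_collect_sigma)
    show "indep_sets draw_events (\<Union>b\<in>UNIV. ?I b)"
      by (rule indep_sets_mono_index[OF _ indep_draw_events]) (use assms(1) in auto)
    show "disjoint_family_on ?I UNIV" by (auto simp: disjoint_family_on_def)
  qed (rule Int_stable_draw_events)
  from indep_setsD[OF this, of UNIV "\<lambda>b. if b then H else G"] assms(2,3)
  show ?thesis by (auto simp: UNIV_bool past_def future_def Int_commute mult.commute)
qed

lemma past_sub: "past n \<subseteq> events"
  unfolding past_def by (intro sets.sigma_sets_subset UN_least draw_events_sub) auto

lemma past_mono: "m \<le> n \<Longrightarrow> past m \<subseteq> past n"
  unfolding past_def by (intro sigma_sets_mono' UN_mono) auto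

lemma sigma_algebra_past: "sigma_algebra (space M) (past n)"
  unfolding past_def by (rule sigma_algebra_sigma_sets) (auto simp: draw_events_def)

lemma sigma_algebra_future: "sigma_algebra (space M) (future n)"
  unfolding future_def by (rule sigma_algebra_sigma_sets) (auto simp: draw_events_def)

lemma draw_in_draw_events:
  "U1 n -` B \<inter> space M \<in> draw_events (Inl n)" "U2 n -` B \<inter> space M \<in> draw_events (Inr n)"
  by (auto simp: draw_events_def)

lemma draw_in_past:
  assumes "1 \<le> n" "n < m"
  shows "U1 n -` B \<inter> space M \<in> past m" "U2 n -` B \<inter> space M \<in> past m"
  unfolding past_def using assms
  by (intro sigma_sets.Basic UN_I[of "Inl n"] UN_I[of "Inr n"] draw_in_draw_events; auto)+

lemma draw_in_future:
  assumes "m \<le> n"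
  shows "U1 n -` B \<inter> space M \<in> future m" "U2 n -` B \<inter> space M \<in> future m"
  unfolding future_def using assms
  by (intro sigma_sets.Basic UN_I[of "Inl n"] UN_I[of "Inr n"] draw_in_draw_events; auto)+

lemma \<xi>_in_past: "n \<ge> 1 \<Longrightarrow> \<xi> n -` B \<inter> space M \<in> past n"
proof (induction n arbitrary: B rule: dec_induct)
  case base
  interpret sigma_algebra "space M" "past 1" by (rule sigma_algebra_past)
  have "\<xi> 1 -` B \<inter> space M = (if {{1, 2}} \<in> B then space M else {})" using initial by auto
  then show ?case using top empty_sets by (simp only: split: if_split) simp
next
  case (step n)
  interpret sigma_algebra "space M" "past (Suc n)" by (rule sigma_algebra_past)
  let ?F = "\<lambda>a b. (U1 n -` {a} \<inter> space M) \<inter> (U2 n -` {b} \<inter> space M) \<inter>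
      (\<xi> n -` {X. pairing_step n X a b \<in> B} \<inter> space M)"
  have "\<xi> (Suc n) -` B \<inter> space M = (\<Union>a. \<Union>b. ?F a b)"
    using dynamic_pairing.step[OF dynamic_pairing_axioms step(1)] by auto
  moreover have "?F a b \<in> past (Suc n)" for a b
    by (rule Int[OF Int[OF draw_in_past[OF step(1)]] subsetD[OF past_mono step.IH]]) simp_all
  then have "(\<Union>a. \<Union>b. ?F a b) \<in> past (Suc n)"
    by (intro countable_UN image_subsetI)
  ultimately show ?case by (simp only:)
qed

text \<open>On the event that \<open>\<xi>\<close> is in a given state at time \<open>n\<close>, an event about the states after time
  \<open>n\<close> is an event about the draws from time \<open>n\<close> on; by independence this is the Markov property.\<close>

lemma future_state_localized:
  assumes n: "n \<ge> 1" and A: "A \<in> future_sigma M \<xi> n"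
  shows "\<exists>G\<in>future n. A \<inter> \<xi> n -` {X} = G \<inter> \<xi> n -` {X}"
proof -
  interpret sigma_algebra "space M" "future n" by (rule sigma_algebra_future)
  have later: "\<exists>G\<in>future n. (\<xi> k -` B \<inter> space M) \<inter> \<xi> n -` {X} = G \<inter> \<xi> n -` {X}"
    if "k \<ge> n" for k B
    using that
  proof (induction k arbitrary: B rule: dec_induct)
    case base
    show ?case by (rule bexI[of _ "if X \<in> B then space M else {}"]) auto
  next
    case (step k)
    have "\<forall>a b. \<exists>G\<in>future n.
        (\<xi> k -` {Y. pairing_step k Y a b \<in> B} \<inter> space M) \<inter> \<xi> n -` {X} = G \<inter> \<xi> n -` {X}"
      using step.IH by blast
    then obtain G where G: "\<And>a b. G a b \<in> future n"
      "\<And>a b. (\<xi> k -` {Y. pairing_step k Y a b \<in> B} \<inter> space M) \<inter> \<xi> n -` {X} =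
        G a b \<inter> \<xi> n -` {X}"
      by metis
    let ?D = "\<lambda>a b. (U1 k -` {a} \<inter> space M) \<inter> (U2 k -` {b} \<inter> space M)"
    have "\<xi> (Suc k) -` B \<inter> space M =
        (\<Union>a. \<Union>b. ?D a b \<inter> (\<xi> k -` {Y. pairing_step k Y a b \<in> B} \<inter> space M))"
      using dynamic_pairing.step[OF dynamic_pairing_axioms, of k] step(1) n by auto
    moreover have "(\<Union>a. \<Union>b. D a b \<inter> E a b) \<inter> Z = (\<Union>a. \<Union>b. D a b \<inter> G a b) \<inter> Z"
      if "\<And>a b. E a b \<inter> Z = G a b \<inter> Z" for D E and Z :: "'a set"
    proof -
      have "x \<in> E a b \<and> x \<in> Z \<longleftrightarrow> x \<in> G a b \<and> x \<in> Z" for x a b using that[of a b] by blast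
      then show ?thesis unfolding set_eq_iff Int_iff UN_iff by blast
    qed
    note this[OF G(2), of ?D]
    ultimately have "(\<xi> (Suc k) -` B \<inter> space M) \<inter> \<xi> n -` {X} =
        (\<Union>a. \<Union>b. ?D a b \<inter> G a b) \<inter> \<xi> n -` {X}" by (simp only:)
    moreover have "(\<Union>a. \<Union>b. ?D a b \<inter> G a b) \<in> future n"
      by (intro countable_UN image_subsetI Int[OF Int[OF draw_in_future[OF step(1)]] G(1)])
    ultimately show ?case by blast
  qed
  from A show ?thesis unfolding future_sigma_def
  proof (induction A rule: sigma_sets.induct)
    case (Basic A)
    then obtain k B where "k \<ge> n + 1" "A = \<xi> k -` B \<inter> space M" by auto
    then show ?case using later[of k B] by simp
  next
    case Empty
    then show ?case by (intro bexI[of _ "{}"]) auto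
  next
    case (Compl A)
    then obtain G where G: "G \<in> future n" "A \<inter> \<xi> n -` {X} = G \<inter> \<xi> n -` {X}" by blast
    have "(space M - A) \<inter> \<xi> n -` {X} = (space M - G) \<inter> \<xi> n -` {X}" using G(2) by blast
    then show ?case using G(1) by blast
  next
    case (Union A)
    then obtain G where G: "\<And>i::nat. G i \<in> future n"
      "\<And>i. A i \<inter> \<xi> n -` {X} = G i \<inter> \<xi> n -` {X}" by metis
    have "(\<Union>i. A i) \<inter> \<xi> n -` {X} = (\<Union>i. G i) \<inter> \<xi> n -` {X}" using G(2) by blast
    moreover have "(\<Union>i. G i) \<in> future n" using G(1) by (intro countable_UN) auto
    ultimately show ?case by blast
  qed
qed

lemma draws_measurable:
  assumes "n \<ge> 1"
  shows "U1 n \<in> measurable M (count_space UNIV)" "U2 n \<in> measurable M (count_space UNIV)"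
proof -
  have "case_sum U1 U2 i \<in> measurable M (count_space UNIV)" if "i \<in> {1..} <+> {1..}" for i
    using indep_draws that unfolding indep_vars_def2 by blast
  from this[of "Inl n"] this[of "Inr n"] assms
  show "U1 n \<in> measurable M (count_space UNIV)" "U2 n \<in> measurable M (count_space UNIV)"
    by auto
qed

lemma draws_in_range:
  "AE \<omega> in M. \<forall>n\<ge>1. U1 n \<omega> \<in> {1..2 * n} \<and> U2 n \<omega> \<in> {1..2 * n + 1}"
proof -
  note rv = draws_measurable
  have "AE \<omega> in M. U1 n \<omega> \<in> {1..2 * n} \<and> U2 n \<omega> \<in> {1..2 * n + 1}" if n: "n \<ge> 1" for n
  proof -
    have "AE x in measure_pmf (pmf_of_set {1..2 * n}). x \<in> {1..2 * n}"
      using n by (simp add: AE_measure_pmf_iff)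
    then have "AE \<omega> in M. U1 n \<omega> \<in> {1..2 * n}"
      unfolding uniform_U1[OF n, symmetric] by (rule AE_distrD[OF rv(1)[OF n]])
    moreover have "AE x in measure_pmf (pmf_of_set {1..2 * n + 1}). x \<in> {1..2 * n + 1}"
      by (simp add: AE_measure_pmf_iff)
    then have "AE \<omega> in M. U2 n \<omega> \<in> {1..2 * n + 1}"
      unfolding uniform_U2[OF n, symmetric] by (rule AE_distrD[OF rv(2)[OF n]])
    ultimately show ?thesis by auto
  qed
  then show ?thesis by (simp add: AE_all_countable AE_impI)
qed

lemma \<xi>_matching: "AE \<omega> in M. \<forall>n\<ge>1. \<xi> n \<omega> \<in> pair_sets {1..2 * n} ` matchings n"
  using draws_in_range AE_space
proof eventually_elim
  case (elim \<omega>)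
  show ?case
  proof (intro allI impI)
    fix n :: nat assume "n \<ge> 1"
    then show "\<xi> n \<omega> \<in> pair_sets {1..2 * n} ` matchings n"
    proof (induction n rule: dec_induct)
      case base
      let ?p = "\<lambda>x::nat. if x = 1 then 2 else if x = 2 then 1 else x"
      have "{1..2} = {1, 2 :: nat}" by auto
      then have "{{1, 2}} = pair_sets {1..2 * 1} ?p" and p: "?p \<in> matchings 1"
        by (auto simp: pair_sets_def matchings_on_def)
      then have "\<xi> 1 \<omega> = pair_sets {1..2 * 1} ?p" using initial elim by simp
      then show ?case using p by (rule image_eqI)
    next
      case (step n)
      then obtain p where p: "p \<in> matchings n" "\<xi> n \<omega> = pair_sets {1..2 * n} p" by blast
      have u: "U1 n \<omega> \<in> {1..2 * n}" "U2 n \<omega> \<in> {1..2 * n + 1}" using elim step(1) by auto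
      have "\<xi> (Suc n) \<omega> = pairing_step n (\<xi> n \<omega>) (U1 n \<omega>) (U2 n \<omega>)"
        using dynamic_pairing.step[OF dynamic_pairing_axioms step(1), of \<omega>] elim by simp
      also have "\<dots> = pair_sets {1..2 * Suc n} (next_matching n p (U1 n \<omega>) (U2 n \<omega>))"
        unfolding p(2) pairing_step_pair_sets[OF p(1) u] by simp
      finally show ?case
        using next_matching_in[OF p(1) u] unfolding Suc_eq_plus1 by (rule image_eqI)
    qed
  qed
qed

lemma prob_draws:
  assumes n: "n \<ge> 1" and H: "H \<in> past n" and u: "u1 \<in> {1..2 * n}" "u2 \<in> {1..2 * n + 1}"
  shows "prob (H \<inter> ((U1 n -` {u1} \<inter> space M) \<inter> (U2 n -` {u2} \<inter> space M))) =
    prob H / (2 * n * (2 * n + 1))"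
proof -
  let ?E = "U1 n -` {u1} \<inter> space M" and ?F = "U2 n -` {u2} \<inter> space M"
  interpret F: sigma_algebra "space M" "future n" by (rule sigma_algebra_future)
  note rv = draws_measurable[OF n]
  have "prob ?E = measure (distr M (count_space UNIV) (U1 n)) {u1}"
    using rv(1) by (simp add: measure_distr)
  also have "\<dots> = 1 / (2 * n)"
    unfolding uniform_U1[OF n] using u n by (simp add: measure_pmf_single)
  finally have E: "prob ?E = 1 / (2 * n)" .
  have "prob ?F = measure (distr M (count_space UNIV) (U2 n)) {u2}"
    using rv(2) by (simp add: measure_distr)
  also have "\<dots> = 1 / (2 * n + 1)"
    unfolding uniform_U2[OF n] using u by (simp add: measure_pmf_single)
  finally have F: "prob ?F = 1 / (2 * n + 1)" .
  have "prob (\<Inter>i\<in>{Inl n, Inr n}. case_sum (\<lambda>_. ?E) (\<lambda>_. ?F) i) =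
      (\<Prod>i\<in>{Inl n, Inr n}. prob (case_sum (\<lambda>_. ?E) (\<lambda>_. ?F) i))"
    by (rule indep_setsD[OF indep_draw_events]) (use n draw_in_draw_events in auto)
  then have EF: "prob (?E \<inter> ?F) = prob ?E * prob ?F" by simp
  have "?E \<inter> ?F \<in> future n" using draw_in_future[of n n] by blast
  from indep_past_future[OF n H this] show ?thesis unfolding EF E F by (simp add: algebra_simps)
qed

lemma state_event_in_past: "n \<ge> 1 \<Longrightarrow> state_event n p \<in> past n"
  unfolding state_event_def by (rule \<xi>_in_past)

lemma state_event_disjoint:
  assumes "p \<in> matchings n" "q \<in> matchings n" "p \<noteq> q"
  shows "state_event n p \<inter> state_event n q = {}"
  using pair_sets_inject[OF assms(1,2)] assms(3) by (auto simp: state_event_def)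

lemma finite_matchings: "finite (matchings n)"
  by (rule finite_matchings_on) simp

lemma prob_sum_states:
  assumes n: "n \<ge> 1" and A: "A \<in> events"
  shows "prob A = (\<Sum>p\<in>matchings n. prob (A \<inter> state_event n p))"
proof -
  have ev: "state_event n p \<in> events" for p using state_event_in_past[OF n] past_sub by blast
  have "prob A = prob (\<Union>p\<in>matchings n. A \<inter> state_event n p)"
  proof (rule measure_eq_AE)
    show "AE \<omega> in M. \<omega> \<in> A \<longleftrightarrow> \<omega> \<in> (\<Union>p\<in>matchings n. A \<inter> state_event n p)"
      using \<xi>_matching AE_space
      by eventually_elim (use n in \<open>auto simp: state_event_def\<close>)
  qed (use A ev finite_matchings in auto)
  also have "\<dots> = (\<Sum>p\<in>matchings n. prob (A \<inter> state_event n p))"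
  proof (rule finite_measure_finite_Union[OF finite_matchings])
    show "disjoint_family_on (\<lambda>p. A \<inter> state_event n p) (matchings n)"
      unfolding disjoint_family_on_def using state_event_disjoint[of _ n] by blast
  qed (use A ev in auto)
  finally show ?thesis .
qed

definition mass :: "'a set \<Rightarrow> nat \<Rightarrow> (nat \<Rightarrow> nat) \<Rightarrow> real" where
  "mass H n p = prob (H \<inter> state_event n p)"

lemma mass_step:
  assumes n: "n \<ge> 1" and H: "H \<in> past n" and q: "q \<in> matchings (n + 1)"
  shows "mass H (n + 1) q = push_forward n (mass H n) q"
proof -
  interpret P: sigma_algebra "space M" "past n" by (rule sigma_algebra_past)
  let ?X = "matchings n \<times> {1..2 * n} \<times> {1..2 * n + 1}"
  define T where "T = {x \<in> ?X. case x of (p, u1, u2) \<Rightarrow> next_matching n p u1 u2 = q}"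
  define F where "F = (\<lambda>(p, u1, u2). (H \<inter> state_event n p) \<inter>
    ((U1 n -` {u1} \<inter> space M) \<inter> (U2 n -` {u2} \<inter> space M)))"
  have finT: "finite T" unfolding T_def using finite_matchings by simp
  have Hev: "H \<in> events" "state_event n p \<in> events" "state_event (n + 1) p \<in> events" for p
    using H past_sub state_event_in_past[OF n] state_event_in_past[of "n + 1"] by auto
  have Dev: "U1 n -` {a} \<inter> space M \<in> events" "U2 n -` {b} \<inter> space M \<in> events" for a b
    using draw_in_past[OF n, of "Suc n"] past_sub by blast+
  have Fev: "F x \<in> events" for x using Hev Dev by (auto simp: F_def split: prod.split)
  have "mass H (n + 1) q = prob (\<Union>x\<in>T. F x)"
    unfolding mass_def
  proof (rule measure_eq_AE)
    show "AE \<omega> in M. \<omega> \<in> H \<inter> state_event (n + 1) q \<longleftrightarrow> \<omega> \<in> (\<Union>x\<in>T. F x)"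
      using \<xi>_matching draws_in_range AE_space
    proof eventually_elim
      case (elim \<omega>)
      obtain p where p: "p \<in> matchings n" "\<xi> n \<omega> = pair_sets {1..2 * n} p" using elim n by auto
      have u: "U1 n \<omega> \<in> {1..2 * n}" "U2 n \<omega> \<in> {1..2 * n + 1}" using elim n by auto
      let ?q = "next_matching n p (U1 n \<omega>) (U2 n \<omega>)"
      have "\<xi> (n + 1) \<omega> = pair_sets {1..2 * (n + 1)} ?q"
        using step[OF n, of \<omega>] elim pairing_step_pair_sets[OF p(1) u] p(2) by simp
      then have "\<omega> \<in> state_event (n + 1) q \<longleftrightarrow> ?q = q"
        using pair_sets_inject[OF next_matching_in[OF p(1) u] q] elim by (auto simp: state_event_def)
      moreover have "\<omega> \<in> (\<Union>x\<in>T. F x) \<longleftrightarrow> \<omega> \<in> H \<and> ?q = q"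
      proof
        assume "\<omega> \<in> (\<Union>x\<in>T. F x)"
        then obtain p' u1 u2 where x: "(p', u1, u2) \<in> T" "\<omega> \<in> F (p', u1, u2)" by auto
        then have "pair_sets {1..2 * n} p' = pair_sets {1..2 * n} p" "p' \<in> matchings n"
          using p(2) by (auto simp: F_def T_def state_event_def)
        then have "p' = p" using pair_sets_inject p(1) by blast
        then show "\<omega> \<in> H \<and> ?q = q" using x by (auto simp: F_def T_def)
      next
        assume "\<omega> \<in> H \<and> ?q = q"
        then have "(p, U1 n \<omega>, U2 n \<omega>) \<in> T" "\<omega> \<in> F (p, U1 n \<omega>, U2 n \<omega>)"
          using p u elim by (auto simp: T_def F_def state_event_def)
        then show "\<omega> \<in> (\<Union>x\<in>T. F x)" by blast
      qed
      ultimately show ?case by blast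
    qed
  qed (use Hev Fev finT in auto)
  also have "\<dots> = (\<Sum>x\<in>T. prob (F x))"
  proof (rule finite_measure_finite_Union[OF finT])
    show "F ` T \<subseteq> events" using Fev by auto
    show "disjoint_family_on F T"
      unfolding disjoint_family_on_def
    proof (intro ballI impI)
      fix x y assume xy: "x \<in> T" "y \<in> T" "x \<noteq> y"
      obtain p a b p' a' b' where e: "x = (p, a, b)" "y = (p', a', b')" by (metis prod_cases3)
      show "F x \<inter> F y = {}"
      proof (cases "p = p'")
        case True
        then show ?thesis using xy e by (auto simp: F_def)
      next
        case False
        then have "state_event n p \<inter> state_event n p' = {}"
          using xy e by (intro state_event_disjoint) (auto simp: T_def)
        then show ?thesis by (auto simp: F_def e)
      qed
    qed
  qed
  also have "\<dots> = (\<Sum>(p, u1, u2)\<in>T. mass H n p / (2 * n * (2 * n + 1)))"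
  proof (rule sum.cong[OF refl])
    fix x assume x: "x \<in> T"
    obtain p u1 u2 where e: "x = (p, u1, u2)" by (metis prod_cases3)
    have "H \<inter> state_event n p \<in> past n" using H state_event_in_past[OF n] by blast
    then show "prob (F x) = (case x of (p, u1, u2) \<Rightarrow> mass H n p / (2 * n * (2 * n + 1)))"
      using prob_draws[OF n, of "H \<inter> state_event n p" u1 u2] x e
      by (simp add: F_def T_def mass_def)
  qed
  also have "\<dots> = (\<Sum>x\<in>?X. if (case x of (p, u1, u2) \<Rightarrow> next_matching n p u1 u2 = q)
      then (case x of (p, u1, u2) \<Rightarrow> mass H n p / (2 * n * (2 * n + 1))) else 0)"
    unfolding T_def by (rule sum.inter_filter) (use finite_matchings in auto)
  also have "\<dots> = (\<Sum>(p, u1, u2)\<in>?X. if next_matching n p u1 u2 = q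
      then mass H n p / (2 * n * (2 * n + 1)) else 0)"
    by (intro sum.cong refl) (auto split: prod.split)
  also have "\<dots> = push_forward n (mass H n) q"
    unfolding push_forward_def
    by (simp only: sum.cartesian_product)
  finally show ?thesis .
qed

text \<open>The signed mass below measures the dependence of \<open>\<xi> n\<close> on the past event \<open>H\<close>. It has total mass
  zero and is transported by the pairing steps, hence it fades.\<close>

lemma dependence_vanishes:
  assumes H: "H \<in> past m"
  shows "(\<lambda>n. sq_density_norm n (\<lambda>p. mass H n p - prob H * mass (space M) n p)) \<longlonglongrightarrow> 0"
proof (rule contracting_sequence_tendsto_0)
  let ?d = "\<lambda>n p. mass H n p - prob H * mass (space M) n p"
  show "sq_density_norm n (?d n) \<ge> 0" for n by (simp add: sq_density_norm_def sum_nonneg)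
  show "max m 1 \<ge> (1::nat)" by simp
  fix n assume "n \<ge> max m 1"
  then have n: "n \<ge> 1" "H \<in> past n" using H past_mono[of m n] by auto
  interpret P: sigma_algebra "space M" "past n" by (rule sigma_algebra_past)
  have "(\<Sum>p\<in>matchings n. mass H n p) = prob H"
    "(\<Sum>p\<in>matchings n. mass (space M) n p) = prob (space M)"
    unfolding mass_def using n(2) past_sub
    by (intro prob_sum_states[OF n(1), symmetric]; blast)+
  then have mean: "(\<Sum>p\<in>matchings n. ?d n p) = 0"
    by (simp add: sum_subtractf sum_distrib_left[symmetric] prob_space)
  have "?d (n + 1) q = push_forward n (?d n) q" if "q \<in> matchings (n + 1)" for q
    using mass_step[OF n(1) _ that] n(2) P.top by (simp add: push_forward_diff)
  then have "sq_density_norm (n + 1) (?d (n + 1)) = sq_density_norm (n + 1) (push_forward n (?d n))"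
    unfolding sq_density_norm_def by (intro arg_cong2[where f = "(*)"] sum.cong refl) simp
  also have "\<dots> \<le> 2 * real n / (2 * real n + 1) * sq_density_norm n (?d n)"
    by (rule sq_density_norm_push_forward[OF n(1) mean])
  finally show "sq_density_norm (n + 1) (?d (n + 1)) \<le>
      2 * real n / (2 * real n + 1) * sq_density_norm n (?d n)" .
qed

lemma future_sigma_sub: "future_sigma M \<xi> t \<subseteq> sigma_sets (space M) (\<Union>n. past n)"
  unfolding future_sigma_def
proof (rule sigma_sets_mono')
  show "(\<Union>n\<in>{t + 1..}. {\<xi> n -` B \<inter> space M |B. B \<in> sets (count_space UNIV)}) \<subseteq> (\<Union>n. past n)"
  proof (rule UN_least)
    fix n assume "n \<in> {t + 1..}"
    then have "\<xi> n -` B \<inter> space M \<in> past n" for B by (intro \<xi>_in_past) simp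
    then show "{\<xi> n -` B \<inter> space M |B. B \<in> sets (count_space UNIV)} \<subseteq> (\<Union>n. past n)" by blast
  qed
qed

lemma events_of_pasts: "sigma_sets (space M) (\<Union>n. past n) \<subseteq> events"
  using past_sub by (intro sets.sigma_sets_subset) auto

text \<open>Given the state at time \<open>n\<close>, the past event \<open>H\<close> influences \<open>A\<close> only through that state, so the
  covariance of \<open>A\<close> and \<open>H\<close> is bounded by the total variation of the signed mass at any time
  \<open>n \<ge> m\<close>.\<close>

lemma tail_indep_past:
  assumes A: "A \<in> tail_sigma M \<xi>" and H: "H \<in> past m"
  shows "prob (A \<inter> H) = prob A * prob H"
proof -
  let ?d = "\<lambda>n p. mass H n p - prob H * mass (space M) n p"
  have A_fut: "A \<in> future_sigma M \<xi> n" for n using A by (auto simp: tail_sigma_def)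
  have Aev: "A \<in> events" using A_fut future_sigma_sub events_of_pasts by blast
  have bound: "(prob (A \<inter> H) - prob A * prob H)\<^sup>2 \<le> sq_density_norm n (?d n)" if "n \<ge> max m 1" for n
  proof -
    have n: "n \<ge> 1" "H \<in> past n" using that H past_mono[of m n] by auto
    interpret P: sigma_algebra "space M" "past n" by (rule sigma_algebra_past)
    obtain G where G: "\<And>p. G p \<in> future n"
      "\<And>p. A \<inter> \<xi> n -` {pair_sets {1..2 * n} p} = G p \<inter> \<xi> n -` {pair_sets {1..2 * n} p}"
    proof -
      have "\<forall>p. \<exists>G\<in>future n.
          A \<inter> \<xi> n -` {pair_sets {1..2 * n} p} = G \<inter> \<xi> n -` {pair_sets {1..2 * n} p}"
        using future_state_localized[OF n(1) A_fut] by blast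
      then show thesis using that by metis
    qed
    have split: "prob (A \<inter> K) = (\<Sum>p\<in>matchings n. prob (G p) * mass K n p)" if K: "K \<in> past n" for K
    proof -
      have "prob (A \<inter> K) = (\<Sum>p\<in>matchings n. prob (A \<inter> K \<inter> state_event n p))"
        using Aev K past_sub by (intro prob_sum_states[OF n(1)]) blast
      also have "\<dots> = (\<Sum>p\<in>matchings n. prob (G p) * mass K n p)"
      proof (rule sum.cong[OF refl])
        fix p
        have "A \<inter> K \<inter> state_event n p = (K \<inter> state_event n p) \<inter> G p"
          using G(2)[of p] unfolding state_event_def by blast
        moreover have "K \<inter> state_event n p \<in> past n"
          using K state_event_in_past[OF n(1)] by blast
        ultimately show "prob (A \<inter> K \<inter> state_event n p) = prob (G p) * mass K n p"
          using indep_past_future[OF n(1) _ G(1)] by (simp add: mass_def mult.commute)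
      qed
      finally show ?thesis .
    qed
    have "A \<inter> space M = A" using Aev sets.sets_into_space by blast
    then have "prob (A \<inter> H) - prob A * prob H =
        (\<Sum>p\<in>matchings n. prob (G p) * mass H n p) -
          prob H * (\<Sum>p\<in>matchings n. prob (G p) * mass (space M) n p)"
      using split[OF n(2)] split[OF P.top] by simp
    also have "\<dots> = (\<Sum>p\<in>matchings n. prob (G p) * ?d n p)"
      unfolding sum_distrib_left sum_subtractf[symmetric]
      by (intro sum.cong refl) (simp add: algebra_simps)
    finally have "prob (A \<inter> H) - prob A * prob H = (\<Sum>p\<in>matchings n. prob (G p) * ?d n p)" .
    then have "\<bar>prob (A \<inter> H) - prob A * prob H\<bar> \<le> (\<Sum>p\<in>matchings n. \<bar>prob (G p) * ?d n p\<bar>)"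
      by (simp only: sum_abs)
    also have "\<dots> \<le> (\<Sum>p\<in>matchings n. \<bar>?d n p\<bar>)"
      by (intro sum_mono) (simp add: abs_mult mult_left_le_one_le)
    finally have "\<bar>prob (A \<inter> H) - prob A * prob H\<bar>\<^sup>2 \<le> (\<Sum>p\<in>matchings n. \<bar>?d n p\<bar>)\<^sup>2"
      by (rule power_mono) simp
    also have "\<dots> \<le> sq_density_norm n (?d n)" by (rule sum_abs_le_sq_density_norm)
    finally show ?thesis by simp
  qed
  have "(prob (A \<inter> H) - prob A * prob H)\<^sup>2 \<le> 0"
    by (rule LIMSEQ_le_const[OF dependence_vanishes[OF H]]) (use bound in blast)
  then show ?thesis by simp
qed

text \<open>The tail event is measurable with respect to the pasts jointly, hence independent of itself.\<close>

theorem tail_trivial: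
  assumes A: "A \<in> tail_sigma M \<xi>"
  shows "prob A = 0 \<or> prob A = 1"
proof -
  have "A \<in> future_sigma M \<xi> 0" using A by (auto simp: tail_sigma_def)
  then have A_sig: "A \<in> sigma_sets (space M) (\<Union>n. past n)" using future_sigma_sub by blast
  then have Aev: "A \<in> events" using events_of_pasts by blast
  have "indep_set {A} (\<Union>n. past n)"
    by (rule indep_setI) (use Aev past_sub tail_indep_past[OF A] in auto)
  then have "indep_set (sigma_sets (space M) {A}) (sigma_sets (space M) (\<Union>n. past n))"
  proof (rule indep_set_sigma_sets)
    show "Int_stable {A}" by (simp add: Int_stable_def)
    show "Int_stable (\<Union>n. past n)"
      unfolding Int_stable_def
    proof (intro ballI)
      fix H K assume "H \<in> (\<Union>n. past n)" "K \<in> (\<Union>n. past n)"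
      then obtain m n where mn: "H \<in> past m" "K \<in> past n" by auto
      interpret sigma_algebra "space M" "past (max m n)" by (rule sigma_algebra_past)
      have "H \<in> past (max m n)" "K \<in> past (max m n)"
        using past_mono[of m "max m n"] past_mono[of n "max m n"] mn by auto
      then show "H \<inter> K \<in> (\<Union>n. past n)" by blast
    qed
  qed
  then have "prob (A \<inter> A) = prob A * prob A"
    by (rule indep_setD[OF _ sigma_sets.Basic A_sig]) simp
  then show ?thesis by simp
qed

end

theorem mainTheorem5:
  fixes M :: "'a measure"
    and U1 U2 :: "nat \<Rightarrow> 'a \<Rightarrow> nat"
    and \<xi> :: "nat \<Rightarrow> 'a \<Rightarrow> nat set set"
  assumes "dynamic_pairing M U1 U2 \<xi>"
  shows "\<forall>A \<in> tail_sigma M \<xi>. measure M A = 0 \<or> measure M A = 1"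
  using dynamic_pairing.tail_trivial[OF assms] by blast

end
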